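(* Let $q\ge1$, $C>0$, $d\in\mathbb{N}$. Let $(A(N),\mathcal{F}_N,x^{0,N})_{N\ge1}$ and $(\tilde A(N),\mathcal{F}_N,x^{0,N})_{N\ge1}$ be any two $(C,d)$-regular polynomial sequences of AMP instances (in $\mathcal{V}_{q,N}$) that differ only in the distribution of the random matrices $A(N)$ and $\tilde A(N)$. Denote by $\{x^t\}_{t\ge0}$ and $\{\tilde x^t\}_{t\ge0}$ the corresponding AMP orbits. Assume further that for all $N$ and all $i<j$, $\mathbb{E}\{A_{ij}^2\}=\mathbb{E}\{\tilde A_{ij}^2\}$. Then, for every $t\ge 0$ and any set of polynomials $\{p_{N,i}\}_{N\ge0,\,1\le i\le N}$, $p_{N,i}:\mathbb{R}^q\to\mathbb{R}$, with degree bounded by $d$ and coefficients bounded by a constant $B$ for all $N$ and $i\in[N]$, $$\lim_{N\to\infty}\frac1N\sum_{i=1}^N\big\{\mathbb{E}\,p_{N,i}(\mathbf{x}^t_i)-\mathbb{E}\,p_{N,i}(\tilde{\mathbf{x}}^t_i)\big\}=0 .$$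
   Context: $\mathcal{V}_{q,N}=(\mathbb{R}^q)^N$; $x\in\mathcal{V}_{q,N}$ is written $x=(\mathbf{x}_1,\dots,\mathbf{x}_N)$ with $\mathbf{x}_i\in\mathbb{R}^q$. $[N]=\{1,\dots,N\}$. An AMP instance is a triple $(A,\mathcal{F},x^0)$ where $A\in\mathbb{R}^{N\times N}$ is symmetric with $A_{ii}=0$ for all $i$; $\mathcal{F}=\{f^k:k\in[N]\}$ is a collection of maps $f^k:\mathbb{R}^q\times\mathbb{N}\to\mathbb{R}^q$, $(\mathbf{x},t)\mapsto f^k(\mathbf{x},t)$, locally Lipschitz in the first argument; and $x^0\in\mathcal{V}_{q,N}$ is an initial condition. The corresponding AMP orbit is $\{x^t\}_{t\ge0}$, $x^t\in\mathcal{V}_{q,N}$, defined for $t\ge0$, $i\in[N]$ by $$\mathbf{x}^{t+1}_i=\sum_{j\in[N]}A_{ij}f^j(\mathbf{x}^t_j,t)-\sum_{j\in[N]}A_{ij}^2\,\frac{\partial f^j}{\partial\mathbf{x}}(\mathbf{x}^t_j,t)\,f^i(\mathbf{x}^{t-1}_i,t-1),$$ where $\frac{\partial f^j}{\partial\mathbf{x}}$ is the ($q\times q$) Jacobian of $f^j(\cdot,t)$ and, for $t=0$, the second sum is absent by convention. A centered random variable $X$ is sub-Gaussian with scale factor $\sigma^2$ if $\mathbb{E}(e^{\lambda X})\le e^{\sigma^2\lambda^2/2}$ for all $\lambda\in\mathbb{R}$. A sequence of AMP instances $\{(A(N),\mathcal{F}_N,x^{0,N})\}_{N\ge1}$, with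 $A(N)$ a random matrix and $x^{0,N}$ a random vector, is a $(C,d)$-regular polynomial sequence if: (1) for each $N$, the entries $(A_{ij}(N))_{1\le i<j\le N}$ are independent centered random variables, sub-Gaussian with common scale factor $C/N$; (2) for each $N$, the functions $f^i(\cdot,t)$ in $\mathcal{F}_N$ (possibly random, as long as they are independent of $A(N)$, $x^{0,N}$) are polynomials with maximum degree $d$ and coefficients bounded by $C$; (3) for each $N$, $A(N)$ and $x^{0,N}$ are independent, and $\sum_{i=1}^N\exp\{\|\mathbf{x}_i^{0,N}\|_2^2/C\}\le NC$ with probability converging to one as $N\to\infty$.
   Formalization: As stated the limit can fail, since x^0 is unconstrained off the event in (3); proved instead: the limit with expectations restricted to that event, and the limit with full expectations if all moments of the empirical distribution of x^0 are finite and bounded in N. *)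

theory Defs
  imports "HOL-Probability.Probability"
begin

text \<open>
  \<open>\<real>\<^sup>q\<close> is \<^typ>\<open>real ^ 'q\<close> with \<open>q = CARD('q)\<close>. A point of \<open>(\<real>\<^sup>q)\<^sup>N\<close> is a function
  \<^typ>\<open>nat \<Rightarrow> real ^ 'q\<close> and an \<open>N \<times> N\<close> matrix a function \<^typ>\<open>nat \<Rightarrow> nat \<Rightarrow> real\<close>; only the
  indices in \<^term>\<open>{1..N}\<close> matter.
\<close>

definition monomials :: "nat \<Rightarrow> ('q::finite \<Rightarrow> nat) set" where
  "monomials d = {m. (\<Sum>s\<in>UNIV. m s) \<le> d}"

lemma finite_monomials: "finite (monomials d :: ('q::finite \<Rightarrow> nat) set)"
proof (rule finite_subset)
  show "(monomials d :: ('q \<Rightarrow> nat) set) \<subseteq> (UNIV :: 'q set) \<rightarrow>\<^sub>E {..d}"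
  proof
    fix m :: "'q \<Rightarrow> nat" assume m: "m \<in> monomials d"
    have "m s \<le> d" for s
      using member_le_sum[of s UNIV m] m by (simp add: monomials_def)
    then show "m \<in> (UNIV :: 'q set) \<rightarrow>\<^sub>E {..d}" by auto
  qed
  show "finite ((UNIV :: 'q set) \<rightarrow>\<^sub>E {..d})" by (simp add: finite_PiE)
qed

text \<open>The polynomial of degree at most \<open>d\<close> in \<open>q\<close> variables with coefficients \<open>c\<close>.\<close>

definition poly_val :: "nat \<Rightarrow> (('q::finite \<Rightarrow> nat) \<Rightarrow> real) \<Rightarrow> real ^ 'q \<Rightarrow> real" where
  "poly_val d c x = (\<Sum>m\<in>monomials d. c m * (\<Prod>s\<in>UNIV. (x $ s) ^ m s))"

definition bounded_polynomial :: "nat \<Rightarrow> real \<Rightarrow> (real ^ 'q::finite \<Rightarrow> real) \<Rightarrow> bool" where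
  "bounded_polynomial d B p \<longleftrightarrow> (\<exists>c. (\<forall>m\<in>monomials d. \<bar>c m\<bar> \<le> B) \<and> p = poly_val d c)"

text \<open>
  The collection of polynomial maps \<open>f\<^sup>k(\<cdot>, t) : \<real>\<^sup>q \<rightarrow> \<real>\<^sup>q\<close> with coefficients \<open>c k t s m\<close>
  (\<open>s\<close> the output component, \<open>m\<close> the monomial); the arguments are \<open>k\<close>, \<open>t\<close>, \<open>x\<close> in this order.
\<close>

definition poly_maps ::
    "nat \<Rightarrow> (nat \<Rightarrow> nat \<Rightarrow> 'q::finite \<Rightarrow> ('q \<Rightarrow> nat) \<Rightarrow> real) \<Rightarrow> nat \<Rightarrow> nat \<Rightarrow> real ^ 'q \<Rightarrow> real ^ 'q" where
  "poly_maps d c k t x = (\<chi> s. poly_val d (c k t s) x)"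

text \<open>The initial condition of an instance is unconstrained, hence not an argument here.\<close>

definition amp_instance ::
    "nat \<Rightarrow> (nat \<Rightarrow> nat \<Rightarrow> real) \<Rightarrow> (nat \<Rightarrow> nat \<Rightarrow> real ^ 'q::finite \<Rightarrow> real ^ 'q) \<Rightarrow> bool" where
  "amp_instance N A f \<longleftrightarrow>
     (\<forall>i\<in>{1..N}. \<forall>j\<in>{1..N}. A i j = A j i) \<and>
     (\<forall>i\<in>{1..N}. A i i = 0) \<and>
     (\<forall>k\<in>{1..N}. \<forall>t x. \<exists>u>0. \<exists>L. L-lipschitz_on (cball x u) (f k t))"

fun amp_orbit ::
    "nat \<Rightarrow> (nat \<Rightarrow> nat \<Rightarrow> real) \<Rightarrow> (nat \<Rightarrow> nat \<Rightarrow> real ^ 'q::finite \<Rightarrow> real ^ 'q) \<Rightarrow> (nat \<Rightarrow> real ^ 'q)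
      \<Rightarrow> nat \<Rightarrow> nat \<Rightarrow> real ^ 'q" where
  "amp_orbit N A f x0 0 i = x0 i"
| "amp_orbit N A f x0 (Suc 0) i = (\<Sum>j=1..N. A i j *\<^sub>R f j 0 (x0 j))"
| "amp_orbit N A f x0 (Suc (Suc t)) i =
     (\<Sum>j=1..N. A i j *\<^sub>R f j (Suc t) (amp_orbit N A f x0 (Suc t) j)) -
     (\<Sum>j=1..N. (A i j)\<^sup>2 *\<^sub>R
        (jacobian (f j (Suc t)) (at (amp_orbit N A f x0 (Suc t) j)) *v
           f i t (amp_orbit N A f x0 t i)))"

definition subgaussian :: "'w measure \<Rightarrow> ('w \<Rightarrow> real) \<Rightarrow> real \<Rightarrow> bool" where
  "subgaussian M X v \<longleftrightarrow>
     (\<forall>l. integrable M (\<lambda>\<omega>. exp (l * X \<omega>)) \<and> (LINT \<omega>|M. exp (l * X \<omega>)) \<le> exp (v * l\<^sup>2 / 2))"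

text \<open>
  Independence of two random variables; unlike \<^const>\<open>prob_space.indep_var\<close> it allows
  values of different types.
\<close>

definition indep_rv ::
    "'w measure \<Rightarrow> 'a measure \<Rightarrow> ('w \<Rightarrow> 'a) \<Rightarrow> 'b measure \<Rightarrow> ('w \<Rightarrow> 'b) \<Rightarrow> bool" where
  "indep_rv M S X T Y \<longleftrightarrow>
     X \<in> measurable M S \<and> Y \<in> measurable M T \<and>
     prob_space.indep_set M {X -` U \<inter> space M |U. U \<in> sets S} {Y -` V \<inter> space M |V. V \<in> sets T}"

definition upper_pairs :: "nat \<Rightarrow> (nat \<times> nat) set" where
  "upper_pairs N = {(i, j). 1 \<le> i \<and> i < j \<and> j \<le> N}"

definition matrix_space :: "nat \<Rightarrow> (nat \<times> nat \<Rightarrow> real) measure" where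
  "matrix_space N = PiM (upper_pairs N) (\<lambda>_. borel)"

definition matrix_rv :: "nat \<Rightarrow> ('w \<Rightarrow> nat \<Rightarrow> nat \<Rightarrow> real) \<Rightarrow> 'w \<Rightarrow> nat \<times> nat \<Rightarrow> real" where
  "matrix_rv N A \<omega> = (\<lambda>(i, j)\<in>upper_pairs N. A \<omega> i j)"

definition initial_space :: "nat \<Rightarrow> (nat \<Rightarrow> real ^ 'q::finite) measure" where
  "initial_space N = PiM {1..N} (\<lambda>_. borel)"

definition initial_rv :: "nat \<Rightarrow> ('w \<Rightarrow> nat \<Rightarrow> real ^ 'q::finite) \<Rightarrow> 'w \<Rightarrow> nat \<Rightarrow> real ^ 'q" where
  "initial_rv N x0 \<omega> = (\<lambda>i\<in>{1..N}. x0 \<omega> i)"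

definition coeff_index :: "nat \<Rightarrow> nat \<Rightarrow> (nat \<times> nat \<times> 'q::finite \<times> ('q \<Rightarrow> nat)) set" where
  "coeff_index d N = {1..N} \<times> UNIV \<times> UNIV \<times> monomials d"

definition coeff_space ::
    "nat \<Rightarrow> nat \<Rightarrow> (nat \<times> nat \<times> 'q::finite \<times> ('q \<Rightarrow> nat) \<Rightarrow> real) measure" where
  "coeff_space d N = PiM (coeff_index d N) (\<lambda>_. borel)"

definition coeff_rv ::
    "nat \<Rightarrow> nat \<Rightarrow> ('w \<Rightarrow> nat \<Rightarrow> nat \<Rightarrow> 'q::finite \<Rightarrow> ('q \<Rightarrow> nat) \<Rightarrow> real)
      \<Rightarrow> 'w \<Rightarrow> nat \<times> nat \<times> 'q \<times> ('q \<Rightarrow> nat) \<Rightarrow> real" where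
  "coeff_rv d N c \<omega> = (\<lambda>(i, t, s, m)\<in>coeff_index d N. c \<omega> i t s m)"

text \<open>
  The event of the exponential moment bound on the initial condition. Regularity requires its
  probability to tend to one and leaves the initial condition arbitrary off it, so unrestricted
  expectations of polynomials of the orbits need neither exist nor have comparable limits: with
  probability \<open>1 / N\<close> all entries of the initial condition may be huge. Expectations restricted
  to this event are always controlled.
\<close>

definition tame_event ::
    "real \<Rightarrow> nat \<Rightarrow> 'w measure \<Rightarrow> ('w \<Rightarrow> nat \<Rightarrow> real ^ 'q::finite) \<Rightarrow> 'w set" where
  "tame_event C N M x0 = {\<omega>\<in>space M. (\<Sum>i=1..N. exp ((norm (x0 \<omega> i))\<^sup>2 / C)) \<le> real N * C}"

text \<open>
  \<open>(C, d)\<close>-regular polynomial sequences of instances \<open>(A(N), \<F>\<^sub>N, x\<^sup>0\<^sup>,\<^sup>N)\<close>, living on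
  probability spaces \<open>M N\<close>. The possibly random collection \<open>\<F>\<^sub>N\<close> is represented by its
  coefficients: \<open>\<F>\<^sub>N\<close> at \<open>\<omega>\<close> is \<^term>\<open>poly_maps d (c N \<omega>)\<close>. It is independent of the pair
  \<open>(A(N), x\<^sup>0\<^sup>,\<^sup>N)\<close>.
\<close>

definition regular_polynomial_sequence ::
    "real \<Rightarrow> nat \<Rightarrow> (nat \<Rightarrow> 'w measure) \<Rightarrow> (nat \<Rightarrow> 'w \<Rightarrow> nat \<Rightarrow> nat \<Rightarrow> real)
      \<Rightarrow> (nat \<Rightarrow> 'w \<Rightarrow> nat \<Rightarrow> nat \<Rightarrow> 'q::finite \<Rightarrow> ('q \<Rightarrow> nat) \<Rightarrow> real)
      \<Rightarrow> (nat \<Rightarrow> 'w \<Rightarrow> nat \<Rightarrow> real ^ 'q) \<Rightarrow> bool" where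
  "regular_polynomial_sequence C d M A c x0 \<longleftrightarrow>
     (\<forall>N\<ge>1.
        prob_space (M N) \<and>
        (\<forall>\<omega>\<in>space (M N). amp_instance N (A N \<omega>) (poly_maps d (c N \<omega>))) \<and>
        prob_space.indep_vars (M N) (\<lambda>_. borel) (\<lambda>(i, j) \<omega>. A N \<omega> i j) (upper_pairs N) \<and>
        (\<forall>(i, j)\<in>upper_pairs N.
           integrable (M N) (\<lambda>\<omega>. A N \<omega> i j) \<and> (LINT \<omega>|M N. A N \<omega> i j) = 0 \<and>
           subgaussian (M N) (\<lambda>\<omega>. A N \<omega> i j) (C / real N)) \<and>
        (\<forall>\<omega>\<in>space (M N). \<forall>(i, t, s, m)\<in>coeff_index d N. \<bar>c N \<omega> i t s m\<bar> \<le> C) \<and>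
        indep_rv (M N) (coeff_space d N) (coeff_rv d N (c N))
          (matrix_space N \<Otimes>\<^sub>M initial_space N)
          (\<lambda>\<omega>. (matrix_rv N (A N) \<omega>, initial_rv N (x0 N) \<omega>)) \<and>
        indep_rv (M N) (matrix_space N) (matrix_rv N (A N)) (initial_space N) (initial_rv N (x0 N))) \<and>
     (\<lambda>N. measure (M N) (tame_event C N (M N) (x0 N))) \<longlonglongrightarrow> 1"

text \<open>
  All moments of the empirical distribution of the initial condition are finite and bounded
  as \<open>N \<rightarrow> \<infinity>\<close>.
\<close>

definition bounded_initial_moments ::
    "(nat \<Rightarrow> 'w measure) \<Rightarrow> (nat \<Rightarrow> 'w \<Rightarrow> nat \<Rightarrow> real ^ 'q::finite) \<Rightarrow> bool" where
  "bounded_initial_moments M x0 \<longleftrightarrow>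
     (\<forall>k::nat. \<exists>K. \<forall>\<^sub>F N in sequentially.
        (\<forall>i\<in>{1..N}. integrable (M N) (\<lambda>\<omega>. norm (x0 N \<omega> i) ^ k)) \<and>
        (1 / real N) * (\<Sum>i=1..N. LINT \<omega>|M N. norm (x0 N \<omega> i) ^ k) \<le> K)"

end

theory Submission
  imports Defs
begin

text \<open>
  A polynomial of the coordinates of \<open>x\<^sup>t\<^sub>i\<close> is a bounded number of sums, over labellings of the
  vertices of a tree rooted at \<open>i\<close> by elements of \<open>{1..N}\<close>, of a weight depending on the
  coefficients and the initial condition times the product of the matrix entries along the \<open>m\<close>
  edges (counted with multiplicity). The weight is independent of the matrix, so the expectation of
  a summand factors over the distinct pairs of labels joined by an edge. It vanishes if some pair
  is used once, it agrees for both matrices if each pair is used exactly twice, and otherwise it is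
  \<open>O(N\<^bsup>-m/2\<^esup>)\<close> while, by connectedness, at most \<open>(m + 1) / 2\<close> distinct labels occur. Counting
  labellings, the average over \<open>i\<close> of the differences is \<open>O(N\<^bsup>-1/2\<^esup>)\<close> times an averaged moment of
  the initial condition. The special form of the memory term plays no role.
\<close>

section \<open>Sums over lists of labels\<close>

text \<open>Two obstacles shape the details. The entries of the initial condition may depend on each
  other, and only vertex averages of moments at a single vertex are controlled; a product of weights
  over a tree must therefore be reduced to a power at one vertex before it is averaged. And no
  constant may depend on \<open>N\<close>: the orbit is expanded once, for all \<open>N\<close> and
  all symmetric matrices, into a fixed list of tree shapes in which the numbers of vertices and
  edges and the growth exponents are fixed, while labels, coefficients and initial values vary. The
  final rate arises as follows. A surviving summand with \<open>V\<close> distinct labels is of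
  order \<open>N^(1/2 - V)\<close>, and the labellings with \<open>V\<close> distinct labels, root
  included, number at most a constant times \<open>N^V\<close>. The total is of order
  \<open>N^(1/2)\<close>, of which the average over the root leaves \<open>N^(-1/2)\<close>.
  Labellings are never sorted by \<open>V\<close>; instead the factor
  \<open>1 / real N ^ card\<close> is kept under the sum. The memory term fits the scheme because
  squared entries are double edges and entries of the Jacobian are again polynomials.\<close>

definition label_lists :: "nat \<Rightarrow> nat \<Rightarrow> nat list set" where
  "label_lists N n = {u. set u \<subseteq> {1..N} \<and> length u = n}"

lemma finite_label_lists [simp]: "finite (label_lists N n)"
  unfolding label_lists_def by (simp add: finite_lists_length_eq)

lemma label_lists_0 [simp]: "label_lists N 0 = {[]}"
  by (auto simp: label_lists_def)

lemma sum_label_lists_Suc: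
  "(\<Sum>w\<in>label_lists N (Suc n). f w) = (\<Sum>i=1..N. \<Sum>u\<in>label_lists N n. f (i # u))"
proof -
  have "label_lists N (Suc n) = (\<lambda>(i, u). i # u) ` ({1..N} \<times> label_lists N n)"
    by (auto simp: label_lists_def length_Suc_conv image_iff)
  moreover have "inj_on (\<lambda>(i, u). i # u) ({1..N} \<times> label_lists N n)"
    by (auto simp: inj_on_def)
  ultimately show ?thesis
    by (simp add: sum.reindex sum.cartesian_product case_prod_unfold)
qed

lemma sum_label_lists_append:
  "(\<Sum>w\<in>label_lists N (n + m). f w) =
     (\<Sum>u\<in>label_lists N n. \<Sum>v\<in>label_lists N m. f (u @ v))"
  by (induction n arbitrary: f) (simp_all add: sum_label_lists_Suc)

text \<open>A letter appended to a list either repeats one of at most \<open>n + 1\<close> values, or it is one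
  of \<open>N\<close> new values and then costs a factor \<open>1 / N\<close>.\<close>

lemma sum_inverse_power_card_le:
  assumes "N \<ge> 1" "finite V" "V \<noteq> {}" "card V \<le> r"
  shows "(\<Sum>u\<in>label_lists N n. 1 / real N ^ card (V \<union> set u)) \<le>
           (real r + real n + 1) ^ n / real N ^ card V"
  using assms(2-)
proof (induction n arbitrary: V r)
  case 0
  then show ?case by simp
next
  case (Suc n)
  \<comment> \<open>The induction hypothesis is taken at \<open>Suc r\<close> in both branches, also
    where \<open>V\<close> does not grow, so that they share the base
    \<open>real r + real n + 2\<close>.\<close>
  have step: "(\<Sum>u\<in>label_lists N n. 1 / real N ^ card (V \<union> set (i # u))) \<le>
      (if i \<in> V then (real r + real n + 2) ^ n / real N ^ card V
       else (real r + real n + 2) ^ n / real N ^ Suc (card V))" for i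
  proof (cases "i \<in> V")
    case True
    then have "V \<union> set (i # u) = V \<union> set u" for u by auto
    then have "(\<Sum>u\<in>label_lists N n. 1 / real N ^ card (V \<union> set (i # u))) \<le>
        (real (Suc r) + real n + 1) ^ n / real N ^ card V"
      using Suc.IH[of V "Suc r"] Suc.prems by simp
    with True show ?thesis by (simp add: algebra_simps)
  next
    case False
    have "(\<Sum>u\<in>label_lists N n. 1 / real N ^ card (insert i V \<union> set u)) \<le>
        (real (Suc r) + real n + 1) ^ n / real N ^ card (insert i V)"
      using Suc.IH[of "insert i V" "Suc r"] Suc.prems False by simp
    moreover have "V \<union> set (i # u) = insert i V \<union> set u" for u by auto
    ultimately show ?thesis using False Suc.prems by (simp add: algebra_simps)
  qed
  let ?Q = "(real r + real n + 2) ^ n"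
  have Q: "?Q \<ge> 0" by simp
  have "(\<Sum>u\<in>label_lists N (Suc n). 1 / real N ^ card (V \<union> set u)) \<le>
      (\<Sum>i=1..N. (if i \<in> V then ?Q / real N ^ card V else ?Q / real N ^ Suc (card V)))"
    unfolding sum_label_lists_Suc by (intro sum_mono step)
  also have "\<dots> = (\<Sum>i\<in>{1..N} \<inter> V. ?Q / real N ^ card V) +
      (\<Sum>i\<in>{1..N} - V. ?Q / real N ^ Suc (card V))"
    by (subst sum.If_cases) (auto simp: Diff_eq)
  also have "\<dots> = real (card ({1..N} \<inter> V)) * (?Q / real N ^ card V) +
      real (card ({1..N} - V)) * (?Q / real N ^ Suc (card V))"
    by simp
  also have "\<dots> \<le> real r * (?Q / real N ^ card V) + real N * (?Q / real N ^ Suc (card V))"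
  proof (intro add_mono mult_right_mono)
    show "real (card ({1..N} \<inter> V)) \<le> real r"
      using Suc.prems card_mono[of V "{1..N} \<inter> V"] by simp
    show "real (card ({1..N} - V)) \<le> real N"
      using card_mono[of "{1..N}" "{1..N} - V"] by simp
  qed (use Q in auto)
  also have "\<dots> = (real r + 1) * ?Q / real N ^ card V"
    using assms(1) by (simp add: field_simps)
  also have "\<dots> \<le> (real r + real (Suc n) + 1) * (real r + real (Suc n) + 1) ^ n / real N ^ card V"
    by (intro divide_right_mono mult_mono power_mono) auto
  finally show ?case by simp
qed

text \<open>Each factor is at most the largest one, and the power of the largest one is a summand on
  the right. This trades a joint moment of several vertices for moments of single vertices.\<close>

lemma prod_list_le_sum_power:
  fixes a :: "nat \<Rightarrow> real"
  assumes "\<And>v. a v \<ge> 1" "w \<noteq> []"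
  shows "(\<Prod>v\<leftarrow>w. a v) \<le> (\<Sum>v\<in>set w. a v ^ length w)"
proof -
  define m where "m = Max (a ` set w)"
  have m: "m \<in> a ` set w" "\<And>v. v \<in> set w \<Longrightarrow> a v \<le> m"
    using assms by (simp_all add: m_def)
  have pos: "0 \<le> a v" for v using assms(1)[of v] by simp
  with m(1) have m0: "0 \<le> m" by auto
  have "(\<Prod>v\<leftarrow>w'. a v) \<le> m ^ length w'" if "set w' \<subseteq> set w" for w'
    using that
  proof (induction w')
    case (Cons x xs)
    then show ?case using m(2)[of x] pos[of x]
      by (auto intro!: mult_mono prod_list_nonneg simp: pos m0)
  qed simp
  then have "(\<Prod>v\<leftarrow>w. a v) \<le> m ^ length w" by blast
  also obtain v where v: "v \<in> set w" "m = a v" using m by auto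
  then have "m ^ length w \<le> (\<Sum>v\<in>set w. a v ^ length w)"
    using member_le_sum[of v "set w" "\<lambda>v. a v ^ length w"] pos by simp
  finally show ?thesis .
qed

text \<open>The vertex \<open>v\<close> that carries the power belongs to \<open>set w\<close>, so
  \<open>set w = {v} \<union> set w\<close>. Once \<open>v\<close> is allowed to range over
  \<open>{1..N}\<close>, the sums can be exchanged, and what remains is a count of labellings around
  the fixed set \<open>{v}\<close>. That set costs one factor \<open>1 / real N\<close>, which turns
  the right side into an average. The base \<open>real n + 3\<close> is that of the count with
  \<open>r = 1\<close> and lists of length \<open>Suc n\<close>.\<close>

lemma sum_prod_list_card_le:
  fixes a :: "nat \<Rightarrow> real"
  assumes "N \<ge> 1" "\<And>v. a v \<ge> 1"
  shows "(\<Sum>w\<in>label_lists N (Suc n). (\<Prod>v\<leftarrow>w. a v) / real N ^ card (set w)) \<le>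
           (real n + 3) ^ Suc n * ((1 / real N) * (\<Sum>v=1..N. a v ^ Suc n))"
proof -
  have pos: "0 \<le> a v" for v using assms(2)[of v] by simp
  have "(\<Sum>w\<in>label_lists N (Suc n). (\<Prod>v\<leftarrow>w. a v) / real N ^ card (set w)) \<le>
      (\<Sum>w\<in>label_lists N (Suc n). \<Sum>v=1..N. a v ^ Suc n * (1 / real N ^ card ({v} \<union> set w)))"
  proof (rule sum_mono)
    fix w assume w: "w \<in> label_lists N (Suc n)"
    then have len: "length w = Suc n" and sub: "set w \<subseteq> {1..N}" and "w \<noteq> []"
      by (auto simp: label_lists_def)
    have "(\<Prod>v\<leftarrow>w. a v) / real N ^ card (set w) \<le> (\<Sum>v\<in>set w. a v ^ Suc n) / real N ^ card (set w)"
      using prod_list_le_sum_power[OF assms(2) \<open>w \<noteq> []\<close>] len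
      by (intro divide_right_mono) (auto simp del: power_Suc)
    also have "\<dots> = (\<Sum>v\<in>set w. a v ^ Suc n * (1 / real N ^ card ({v} \<union> set w)))"
      unfolding sum_divide_distrib by (intro sum.cong) (auto simp: insert_absorb)
    also have "\<dots> \<le> (\<Sum>v=1..N. a v ^ Suc n * (1 / real N ^ card ({v} \<union> set w)))"
      using sub by (intro sum_mono2) (auto simp: pos simp del: power_Suc)
    finally show "(\<Prod>v\<leftarrow>w. a v) / real N ^ card (set w) \<le>
      (\<Sum>v=1..N. a v ^ Suc n * (1 / real N ^ card ({v} \<union> set w)))" .
  qed
  also have "\<dots> = (\<Sum>v=1..N. a v ^ Suc n * (\<Sum>w\<in>label_lists N (Suc n). 1 / real N ^ card ({v} \<union> set w)))"
    by (subst sum.swap) (simp add: sum_distrib_left)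
  also have "\<dots> \<le> (\<Sum>v=1..N. a v ^ Suc n * ((real n + 3) ^ Suc n / real N))"
    using sum_inverse_power_card_le[OF assms(1), of "{_}" 1 "Suc n"]
    by (intro sum_mono mult_left_mono) (auto simp: pos add_ac simp del: power_Suc)
  also have "\<dots> = (real n + 3) ^ Suc n * ((1 / real N) * (\<Sum>v=1..N. a v ^ Suc n))"
    by (simp add: sum_distrib_left sum_distrib_right mult_ac flip: sum_divide_distrib del: power_Suc)
  finally show ?thesis .
qed

section \<open>Expectations of products of matrix entries\<close>

text \<open>A multiset, because the expectation depends on how often each pair of labels occurs in
  the product.\<close>

definition edge_prod :: "(nat \<Rightarrow> nat \<Rightarrow> real) \<Rightarrow> (nat \<times> nat) multiset \<Rightarrow> real" where
  "edge_prod A E = (\<Prod>(i, j)\<in>#E. A i j)"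

lemma edge_prod_empty [simp]: "edge_prod A {#} = 1"
  by (simp add: edge_prod_def)

lemma edge_prod_union [simp]: "edge_prod A (E + F) = edge_prod A E * edge_prod A F"
  by (simp add: edge_prod_def)

lemma edge_prod_replicate [simp]: "edge_prod A (replicate_mset r (i, j)) = A i j ^ r"
  by (induction r) (simp_all add: edge_prod_def)

lemma edge_prod_conv_prod:
  "edge_prod A E = (\<Prod>e\<in>set_mset E. A (fst e) (snd e) ^ count E e)"
  by (simp add: edge_prod_def case_prod_unfold image_prod_mset_multiplicity)

lemma finite_upper_pairs [simp]: "finite (upper_pairs N)"
  by (rule finite_subset[of _ "{1..N} \<times> {1..N}"]) (auto simp: upper_pairs_def)

section \<open>Moments of sub-Gaussian matrix entries\<close>

lemma power_le_fact_exp: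
  assumes "y \<ge> (0 :: real)"
  shows "y ^ k \<le> fact k * exp y"
proof -
  have "y ^ k / fact k = (\<Sum>i\<in>{k}. y ^ i / fact i)" by simp
  also have "\<dots> \<le> (\<Sum>i. y ^ i / fact i)"
    using assms exp_converges[of y] by (intro sum_le_suminf) (auto simp: sums_iff divide_inverse mult.commute)
  also have "\<dots> = exp y"
    using exp_converges[of y] by (simp add: sums_iff divide_inverse mult.commute)
  finally show ?thesis by (simp add: field_simps)
qed

lemma abs_power_le_exp: "\<bar>y\<bar> ^ k \<le> fact k * (exp y + exp (- y))" for y :: real
proof -
  have "\<bar>y\<bar> ^ k \<le> fact k * exp \<bar>y\<bar>" by (rule power_le_fact_exp) simp
  also have "\<dots> \<le> fact k * (exp y + exp (- y))"
    by (intro mult_left_mono) (auto simp: abs_if)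
  finally show ?thesis .
qed

text \<open>The term \<open>2 * fact k * exp (C / 2)\<close> bounds the absolute moment of order
  \<open>k\<close> of an entry rescaled by \<open>sqrt (real N)\<close>. The summand 1 makes the
  constant at least 1, so that additional factors of this kind only enlarge a product.\<close>

definition moment_const :: "real \<Rightarrow> nat \<Rightarrow> real" where
  "moment_const C k = 1 + 2 * fact k * exp (C / 2)"

lemma moment_const_ge_1: "moment_const C k \<ge> 1"
  by (simp add: moment_const_def)

lemma moment_const_mono: "k \<le> m \<Longrightarrow> moment_const C k \<le> moment_const C m"
  unfolding moment_const_def
  by (intro add_left_mono mult_right_mono mult_left_mono fact_mono) auto

text \<open>\<open>H\<close> stands for the sigma-algebra of all randomness outside the matrix.
  Weights will be \<open>H\<close>-measurable, and \<open>indep_H\<close> decouples them from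
  products of matrix entries.\<close>

locale sparse_ensemble = prob_space M for M :: "'w measure" +
  fixes H :: "'w measure" and N :: nat and C :: real and A :: "'w \<Rightarrow> nat \<Rightarrow> nat \<Rightarrow> real"
  assumes N_ge_1: "N \<ge> 1"
    and hollow: "\<And>\<omega> i. \<omega> \<in> space M \<Longrightarrow> i \<in> {1..N} \<Longrightarrow> A \<omega> i i = 0"
    and indep_entries: "indep_vars (\<lambda>_. borel) (\<lambda>(i, j) \<omega>. A \<omega> i j) (upper_pairs N)"
    and centered: "\<And>i j. (i, j) \<in> upper_pairs N \<Longrightarrow> expectation (\<lambda>\<omega>. A \<omega> i j) = 0"
    and subgauss: "\<And>i j. (i, j) \<in> upper_pairs N \<Longrightarrow> subgaussian M (\<lambda>\<omega>. A \<omega> i j) (C / real N)"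
    and space_H: "space H = space M"
    and indep_H: "indep_set (sets H)
      {matrix_rv N A -` U \<inter> space M |U. U \<in> sets (matrix_space N)}"
    and measurable_A: "matrix_rv N A \<in> measurable M (matrix_space N)"
begin

lemma measurable_entry:
  assumes "(i, j) \<in> upper_pairs N"
  shows "(\<lambda>\<omega>. A \<omega> i j) \<in> borel_measurable M"
  using indep_entries assms by (auto simp: indep_vars_def)

text \<open>The exponential moments are used at \<open>l = sqrt (real N)\<close> and at
  \<open>l = - sqrt (real N)\<close>, where the sub-Gaussian exponent becomes \<open>C / 2\<close>
  for every \<open>N\<close>. The sum of these two exponentials dominates any power of the rescaled
  entry.\<close>

lemma entry_moment:
  assumes "(i, j) \<in> upper_pairs N"
  shows "integrable M (\<lambda>\<omega>. A \<omega> i j ^ k)" (is ?int)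
    and "\<bar>expectation (\<lambda>\<omega>. A \<omega> i j ^ k)\<bar> \<le> moment_const C k / sqrt (real N) ^ k" (is ?bound)
proof -
  let ?s = "sqrt (real N)"
  have s: "?s > 0" using N_ge_1 by simp
  have [measurable]: "(\<lambda>\<omega>. A \<omega> i j) \<in> borel_measurable M" by (rule measurable_entry[OF assms])
  have sg: "integrable M (\<lambda>\<omega>. exp (l * A \<omega> i j))"
      "expectation (\<lambda>\<omega>. exp (l * A \<omega> i j)) \<le> exp (C / real N * l\<^sup>2 / 2)" for l
    using subgauss[OF assms] by (auto simp: subgaussian_def)
  let ?g = "\<lambda>\<omega>. fact k * (exp (?s * A \<omega> i j) + exp (- ?s * A \<omega> i j)) / ?s ^ k"
  have le: "\<bar>A \<omega> i j ^ k\<bar> \<le> ?g \<omega>" for \<omega>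
    using abs_power_le_exp[of "?s * A \<omega> i j" k] s
    by (simp add: abs_mult power_mult_distrib power_abs field_simps)
  have int_g: "integrable M ?g"
    by (intro integrable_divide_zero integrable_mult_right Bochner_Integration.integrable_add sg)
  show int: ?int
    by (rule Bochner_Integration.integrable_bound[OF int_g]) (use le in \<open>auto intro: order_trans\<close>)
  have "\<bar>expectation (\<lambda>\<omega>. A \<omega> i j ^ k)\<bar> \<le> expectation (\<lambda>\<omega>. \<bar>A \<omega> i j ^ k\<bar>)"
    by (rule integral_abs_bound)
  also have "\<dots> \<le> expectation ?g"
    by (intro integral_mono int_g integrable_abs int le)
  also have "\<dots> = fact k * (expectation (\<lambda>\<omega>. exp (?s * A \<omega> i j)) +
      expectation (\<lambda>\<omega>. exp (- ?s * A \<omega> i j))) / ?s ^ k"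
    using sg(1)[of ?s] sg(1)[of "- ?s"] by simp
  also have "\<dots> \<le> fact k * (exp (C / 2) + exp (C / 2)) / ?s ^ k"
    using sg(2)[of ?s] sg(2)[of "- ?s"] N_ge_1
    by (intro divide_right_mono mult_left_mono add_mono) auto
  also have "\<dots> \<le> moment_const C k / ?s ^ k"
    using s by (intro divide_right_mono) (auto simp: moment_const_def)
  finally show ?bound .
qed

lemma measurable_edge_prod:
  assumes "set_mset E \<subseteq> upper_pairs N"
  shows "(\<lambda>\<omega>. edge_prod (A \<omega>) E) \<in> borel_measurable M"
  unfolding edge_prod_conv_prod
  using assms by (intro borel_measurable_prod borel_measurable_power measurable_entry) auto

lemma expectation_edge_prod:
  assumes "set_mset E \<subseteq> upper_pairs N"
  shows "integrable M (\<lambda>\<omega>. edge_prod (A \<omega>) E)"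
    and "expectation (\<lambda>\<omega>. edge_prod (A \<omega>) E) =
      (\<Prod>e\<in>set_mset E. expectation (\<lambda>\<omega>. A \<omega> (fst e) (snd e) ^ count E e))"
proof -
  have "indep_vars (\<lambda>_. borel) (\<lambda>(i, j) \<omega>. A \<omega> i j) (set_mset E)"
    using indep_vars_subset[OF indep_entries assms] .
  then have "indep_vars (\<lambda>_. borel)
      (\<lambda>e \<omega>. (case e of (i, j) \<Rightarrow> \<lambda>\<omega>. A \<omega> i j) \<omega> ^ count E e) (set_mset E)"
    by (rule indep_vars_compose2[where Y = "\<lambda>e y. y ^ count E e"]) simp
  then have ind: "indep_vars (\<lambda>_. borel) (\<lambda>e \<omega>. A \<omega> (fst e) (snd e) ^ count E e) (set_mset E)"
    by (simp add: case_prod_unfold)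
  have int: "integrable M (\<lambda>\<omega>. A \<omega> (fst e) (snd e) ^ count E e)" if "e \<in># E" for e
    using that assms entry_moment(1) by (cases e) auto
  show "integrable M (\<lambda>\<omega>. edge_prod (A \<omega>) E)"
    using indep_vars_integrable[OF _ ind int] by (simp add: edge_prod_conv_prod)
  show "expectation (\<lambda>\<omega>. edge_prod (A \<omega>) E) =
      (\<Prod>e\<in>set_mset E. expectation (\<lambda>\<omega>. A \<omega> (fst e) (snd e) ^ count E e))"
    using indep_vars_lebesgue_integral[OF _ ind int] by (simp add: edge_prod_conv_prod)
qed

text \<open>The events of \<open>Z\<close> lie in \<open>H\<close>, and the product of entries is a
  measurable function of the vector of entries above the diagonal, so the independence of the two
  families of events passes to the two variables.\<close>

lemma indep_var_edge_prod:
  assumes Z: "Z \<in> borel_measurable H" and E: "set_mset E \<subseteq> upper_pairs N"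
  shows "indep_var borel Z borel (\<lambda>\<omega>. edge_prod (A \<omega>) E)"
proof -
  let ?Y = "\<lambda>\<omega>. edge_prod (A \<omega>) E"
  let ?\<A> = "{matrix_rv N A -` U \<inter> space M |U. U \<in> sets (matrix_space N)}"
  have H: "sets H \<subseteq> sets M" using indep_setD_ev1[OF indep_H] .
  have Z': "Z \<in> borel_measurable M"
    using Z H space_H by (auto simp: measurable_def)
  \<comment> \<open>Preimages of a sigma-algebra under a map already form a sigma-algebra, so
    passing to the generated one adds no events.\<close>
  have A_sigma: "sigma_sets (space M) ?\<A> = ?\<A>"
    using measurable_space[OF measurable_A]
      sets_vimage_algebra[of "space M" "matrix_rv N A" "matrix_space N"]
      sets_vimage_algebra2[of "matrix_rv N A" "space M" "matrix_space N"] by auto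
  let ?f = "\<lambda>a. \<Prod>e\<in>set_mset E. a e ^ count E e"
  have f: "?f \<in> borel_measurable (matrix_space N)"
    unfolding matrix_space_def using E
    by (intro borel_measurable_prod borel_measurable_power measurable_component_singleton) auto
  have Y_f: "?Y \<omega> = ?f (matrix_rv N A \<omega>)" for \<omega>
    unfolding edge_prod_conv_prod matrix_rv_def
    using E by (intro prod.cong) (auto simp: case_prod_unfold)
  have "{?Y -` U \<inter> space M |U. U \<in> sets borel} \<subseteq> ?\<A>"
  proof safe
    fix U :: "real set" assume U: "U \<in> sets borel"
    have "?f -` U \<inter> space (matrix_space N) \<in> sets (matrix_space N)"
      using f U by (rule measurable_sets)
    moreover have "?Y -` U \<inter> space M = matrix_rv N A -` (?f -` U \<inter> space (matrix_space N)) \<inter> space M"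
      using measurable_space[OF measurable_A] by (auto simp: Y_f)
    ultimately show "\<exists>V. ?Y -` U \<inter> space M = matrix_rv N A -` V \<inter> space M \<and> V \<in> sets (matrix_space N)"
      by blast
  qed
  then have 1: "sigma_sets (space M) {?Y -` U \<inter> space M |U. U \<in> sets borel} \<subseteq> ?\<A>"
    using sigma_sets_mono'[of _ ?\<A> "space M"] unfolding A_sigma by blast
  have "{Z -` U \<inter> space M |U. U \<in> sets borel} \<subseteq> sets H"
    using Z space_H by (auto simp: measurable_def)
  then have 2: "sigma_sets (space M) {Z -` U \<inter> space M |U. U \<in> sets borel} \<subseteq> sets H"
    using sets.sigma_sets_subset[of _ H] space_H by simp
  have "indep_set (sigma_sets (space M) {Z -` U \<inter> space M |U. U \<in> sets borel})
      (sigma_sets (space M) {?Y -` U \<inter> space M |U. U \<in> sets borel})"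
  proof (rule indep_setI)
    show "sigma_sets (space M) {Z -` U \<inter> space M |U. U \<in> sets borel} \<subseteq> events"
      using 2 H by (rule order_trans)
    show "sigma_sets (space M) {?Y -` U \<inter> space M |U. U \<in> sets borel} \<subseteq> events"
      using 1 indep_setD_ev2[OF indep_H] by (rule order_trans)
  qed (use 1 2 in \<open>intro indep_setD[OF indep_H]; auto\<close>)
  then show ?thesis
    unfolding indep_var_eq using Z' measurable_edge_prod[OF E] by simp
qed

lemma expectation_weighted_edge_prod:
  assumes "Z \<in> borel_measurable H" "integrable M Z" "set_mset E \<subseteq> upper_pairs N"
  shows "integrable M (\<lambda>\<omega>. Z \<omega> * edge_prod (A \<omega>) E)"
    and "expectation (\<lambda>\<omega>. Z \<omega> * edge_prod (A \<omega>) E) = expectation Z *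
      (\<Prod>e\<in>set_mset E. expectation (\<lambda>\<omega>. A \<omega> (fst e) (snd e) ^ count E e))"
  using indep_var_integrable[OF indep_var_edge_prod assms(2) expectation_edge_prod(1)]
    indep_var_lebesgue_integral[OF indep_var_edge_prod assms(2) expectation_edge_prod(1)]
    expectation_edge_prod(2) assms by simp_all

text \<open>Neighbouring vertices of a tree may receive the same label. The zero diagonal removes
  these labellings.\<close>

lemma edge_prod_loop:
  assumes "\<omega> \<in> space M" "(i, i) \<in># E" "i \<in> {1..N}"
  shows "edge_prod (A \<omega>) E = 0"
  unfolding edge_prod_conv_prod using assms hollow by (auto intro!: bexI[of _ "(i, i)"])

text \<open>Edges are stored as ordered pairs, so the only pairs of labels outside
  \<^term>\<open>upper_pairs N\<close> are loops.\<close>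

lemma weighted_edge_prod:
  assumes Z: "Z \<in> borel_measurable H" "integrable M Z"
    and E: "\<And>i j. (i, j) \<in># E \<Longrightarrow> 1 \<le> i \<and> i \<le> j \<and> j \<le> N"
  shows "integrable M (\<lambda>\<omega>. Z \<omega> * edge_prod (A \<omega>) E)" (is ?int)
    and "\<bar>expectation (\<lambda>\<omega>. Z \<omega> * edge_prod (A \<omega>) E)\<bar> \<le>
      expectation (\<lambda>\<omega>. \<bar>Z \<omega>\<bar>) * (moment_const C (size E) ^ size E / sqrt (real N) ^ size E)" (is ?bound)
proof -
  let ?K = "moment_const C (size E)" and ?s = "sqrt (real N)"
  have K: "?K \<ge> 1" by (rule moment_const_ge_1)
  have "?int \<and> ?bound"
  proof (cases "set_mset E \<subseteq> upper_pairs N")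
    case True
    have "\<bar>expectation (\<lambda>\<omega>. Z \<omega> * edge_prod (A \<omega>) E)\<bar> = \<bar>expectation Z\<bar> *
        (\<Prod>e\<in>set_mset E. \<bar>expectation (\<lambda>\<omega>. A \<omega> (fst e) (snd e) ^ count E e)\<bar>)"
      by (simp add: expectation_weighted_edge_prod[OF Z True] abs_mult abs_prod)
    also have "\<dots> \<le> expectation (\<lambda>\<omega>. \<bar>Z \<omega>\<bar>) * (\<Prod>e\<in>set_mset E. ?K / ?s ^ count E e)"
    proof (intro mult_mono prod_mono conjI)
      fix e assume e: "e \<in># E"
      have "\<bar>expectation (\<lambda>\<omega>. A \<omega> (fst e) (snd e) ^ count E e)\<bar> \<le>
          moment_const C (count E e) / ?s ^ count E e"
        using entry_moment(2)[of "fst e" "snd e"] e True by auto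
      also have "\<dots> \<le> ?K / ?s ^ count E e"
        by (intro divide_right_mono moment_const_mono count_le_size) auto
      finally show "\<bar>expectation (\<lambda>\<omega>. A \<omega> (fst e) (snd e) ^ count E e)\<bar> \<le> ?K / ?s ^ count E e" .
    qed (auto intro!: prod_nonneg)
    also have "(\<Prod>e\<in>set_mset E. ?K / ?s ^ count E e) = ?K ^ card (set_mset E) / ?s ^ size E"
      by (simp add: prod_dividef size_multiset_overloaded_eq power_sum)
    \<comment> \<open>There is one constant for each distinct edge; since \<open>?K\<close> is at
      least 1, their number may be raised to \<open>size E\<close>.\<close>
    also have "\<dots> \<le> ?K ^ size E / ?s ^ size E"
      using K by (intro divide_right_mono power_increasing)
        (auto simp: size_multiset_overloaded_eq card_eq_sum intro!: sum_mono simp del: sum_constant)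
    finally show ?thesis
      using expectation_weighted_edge_prod(1)[OF Z True] by (simp add: mult_left_mono)
  next
    case False
    then obtain i j where ij: "(i, j) \<in># E" "(i, j) \<notin> upper_pairs N" by auto
    with E[of i j] have "i = j" "i \<in> {1..N}" by (auto simp: upper_pairs_def)
    with ij have 0: "Z \<omega> * edge_prod (A \<omega>) E = 0" if "\<omega> \<in> space M" for \<omega>
      using edge_prod_loop[OF that, of i E] by simp
    have "integrable M (\<lambda>\<omega>. Z \<omega> * edge_prod (A \<omega>) E) \<longleftrightarrow> integrable M (\<lambda>_. 0 :: real)"
      by (intro Bochner_Integration.integrable_cong) (auto simp: 0)
    moreover have "expectation (\<lambda>\<omega>. Z \<omega> * edge_prod (A \<omega>) E) = 0"
      using Bochner_Integration.integral_cong[OF refl 0] by simp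
    ultimately show ?thesis using K by simp
  qed
  then show ?int ?bound by blast+
qed

end

section \<open>Cancellation between the two ensembles for a fixed labelling\<close>

lemma two_card_less_size:
  assumes "\<And>e. e \<in># E \<Longrightarrow> count E e \<ge> 2" "e \<in># E" "count E e \<noteq> 2"
  shows "2 * card (set_mset E) < size E"
proof -
  have "2 * card (set_mset E) = (\<Sum>e\<in>set_mset E. 2)" "size E = (\<Sum>e\<in>set_mset E. count E e)"
    by (simp_all add: size_multiset_overloaded_eq)
  moreover have "(\<Sum>e\<in>set_mset E. 2) < (\<Sum>e\<in>set_mset E. count E e)"
    using assms by (intro sum_strict_mono_ex1) (auto intro!: bexI[of _ e] simp: le_neq_implies_less)
  ultimately show ?thesis by simp
qed

text \<open>\<open>V\<close> will be the number of distinct labels, bounded by connectedness of the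
  tree. The estimate is given in terms of \<open>1 / real N ^ V\<close> because this is the factor
  that the count of labellings absorbs; the price is \<open>sqrt (real N)\<close>.\<close>

lemma weighted_edge_prod_diff:
  assumes ens: "sparse_ensemble M H N C A" "sparse_ensemble M H N C A'"
    and var: "\<And>i j. (i, j) \<in> upper_pairs N \<Longrightarrow>
      (LINT \<omega>|M. (A \<omega> i j)\<^sup>2) = (LINT \<omega>|M. (A' \<omega> i j)\<^sup>2)"
    and Z: "Z \<in> borel_measurable H" "integrable M Z"
    and E: "\<And>i j. (i, j) \<in># E \<Longrightarrow> 1 \<le> i \<and> i \<le> j \<and> j \<le> N"
    and V: "V \<le> Suc (card (set_mset E))"
  shows "\<bar>(LINT \<omega>|M. Z \<omega> * edge_prod (A \<omega>) E) - (LINT \<omega>|M. Z \<omega> * edge_prod (A' \<omega>) E)\<bar> \<le>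
    2 * moment_const C (size E) ^ size E * sqrt (real N) * ((LINT \<omega>|M. \<bar>Z \<omega>\<bar>) / real N ^ V)"
proof -
  interpret A: sparse_ensemble M H N C A by fact
  interpret A': sparse_ensemble M H N C A' by fact
  let ?D = "(LINT \<omega>|M. Z \<omega> * edge_prod (A \<omega>) E) - (LINT \<omega>|M. Z \<omega> * edge_prod (A' \<omega>) E)"
  let ?K = "moment_const C (size E) ^ size E" and ?s = "sqrt (real N)"
  have K: "?K \<ge> 0" using moment_const_ge_1[of C "size E"] by simp
  have s: "?s \<ge> 1" using A.N_ge_1 by simp
  have zero: ?thesis if "?D = 0"
    using that K s by (simp add: integral_nonneg_AE)
  show ?thesis
  proof (cases "set_mset E \<subseteq> upper_pairs N \<and> (\<forall>e\<in>#E. count E e \<ge> 2) \<and> (\<exists>e\<in>#E. count E e \<noteq> 2)")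
    case True
    then have "2 * card (set_mset E) < size E"
      using two_card_less_size[of E] by auto
    \<comment> \<open>Strictness gives \<open>2 * card (set_mset E) + 1 \<le> size E\<close>,
      whereas \<open>2 * V \<le> 2 * card (set_mset E) + 2\<close>. The excess of one is the factor
      \<open>sqrt (real N)\<close> of the bound.\<close>
    with V have le: "2 * V \<le> Suc (size E)" by simp
    have D: "\<bar>?D\<bar> \<le> 2 * ((LINT \<omega>|M. \<bar>Z \<omega>\<bar>) * (?K / ?s ^ size E))"
      using A.weighted_edge_prod(2)[OF Z, of E, OF E] A'.weighted_edge_prod(2)[OF Z, of E, OF E]
      by linarith
    have "?K / ?s ^ size E = ?K * ?s / ?s ^ Suc (size E)"
      using s by simp
    also have "\<dots> \<le> ?K * ?s / ?s ^ (2 * V)"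
      using K s le by (intro divide_left_mono power_increasing) auto
    also have "?s ^ (2 * V) = real N ^ V" by (simp add: power_mult)
    finally have "2 * ((LINT \<omega>|M. \<bar>Z \<omega>\<bar>) * (?K / ?s ^ size E)) \<le>
        2 * ((LINT \<omega>|M. \<bar>Z \<omega>\<bar>) * (?K * ?s / real N ^ V))"
      by (intro mult_left_mono) auto
    with D show ?thesis by (simp add: mult_ac)
  next
    case False
    \<comment> \<open>All remaining cases reduce to \<open>zero\<close>. The first one, a loop, is
      settled by the zero diagonal; the other two use the factorisation over distinct edges.\<close>
    then consider "\<not> set_mset E \<subseteq> upper_pairs N"
      | e where "set_mset E \<subseteq> upper_pairs N" "e \<in># E" "count E e < 2"
      | "set_mset E \<subseteq> upper_pairs N" "\<forall>e\<in>#E. count E e = 2" by force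
    then show ?thesis
    proof cases
      case 1
      then obtain i j where ij: "(i, j) \<in># E" "(i, j) \<notin> upper_pairs N" by auto
      with E[of i j] have "i = j" "i \<in> {1..N}" by (auto simp: upper_pairs_def)
      with ij have eq: "edge_prod (A \<omega>) E = edge_prod (A' \<omega>) E" if "\<omega> \<in> space M" for \<omega>
        using A.edge_prod_loop[OF that, of i E] A'.edge_prod_loop[OF that, of i E] by simp
      have "(LINT \<omega>|M. Z \<omega> * edge_prod (A \<omega>) E) = (LINT \<omega>|M. Z \<omega> * edge_prod (A' \<omega>) E)"
        by (intro Bochner_Integration.integral_cong refl) (simp add: eq)
      then show ?thesis by (intro zero) simp
    next
      case 2
      then have "count E e = 1" by (metis One_nat_def count_greater_zero_iff less_2_cases less_irrefl)
      moreover have "(fst e, snd e) \<in> upper_pairs N" using 2 by auto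
      ultimately have "(LINT \<omega>|M. A \<omega> (fst e) (snd e) ^ count E e) = 0"
          "(LINT \<omega>|M. A' \<omega> (fst e) (snd e) ^ count E e) = 0"
        using A.centered A'.centered by auto
      with 2 have zeros: "(\<Prod>e\<in>set_mset E. LINT \<omega>|M. A \<omega> (fst e) (snd e) ^ count E e) = 0"
          "(\<Prod>e\<in>set_mset E. LINT \<omega>|M. A' \<omega> (fst e) (snd e) ^ count E e) = 0"
        by auto
      show ?thesis
        by (intro zero) (simp only: zeros A.expectation_weighted_edge_prod(2)[OF Z 2(1)]
          A'.expectation_weighted_edge_prod(2)[OF Z 2(1)])
    next
      case 3
      then have "(\<Prod>e\<in>set_mset E. LINT \<omega>|M. A \<omega> (fst e) (snd e) ^ count E e) =
          (\<Prod>e\<in>set_mset E. LINT \<omega>|M. A' \<omega> (fst e) (snd e) ^ count E e)"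
        using var by (intro prod.cong) auto
      then show ?thesis
        using A.expectation_weighted_edge_prod(2)[OF Z 3(1)]
          A'.expectation_weighted_edge_prod(2)[OF Z 3(1)] by (intro zero) simp
    qed
  qed
qed

section \<open>Sums over labelled trees\<close>

text \<open>The entries at \<open>(i, j)\<close> and \<open>(j, i)\<close> are the same random
  variable. Storing the pair in increasing order lets its uses in both directions add up to one
  multiplicity; equal labels give a loop \<open>(i, i)\<close>.\<close>

definition edge :: "nat \<Rightarrow> nat \<Rightarrow> nat \<times> nat" where
  "edge i j = (min i j, max i j)"

lemma edge_prod_edge:
  assumes "\<And>i j. i \<in> {1..N} \<Longrightarrow> j \<in> {1..N} \<Longrightarrow> A i j = A j i" "i \<in> {1..N}" "j \<in> {1..N}"
  shows "edge_prod A (replicate_mset r (edge i j)) = A i j ^ r"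
  using assms by (auto simp: edge_def min_def max_def)

text \<open>
  A template \<open>(n, E, W)\<close> describes the function of the root label \<open>i\<close> that sums, over the labels
  \<open>u\<close> of \<open>n\<close> further vertices, the weight \<open>W N \<omega> i u\<close> times the matrix entries along the edges
  \<open>E i u\<close>.
\<close>

type_synonym 'w template =
  "nat \<times> (nat \<Rightarrow> nat list \<Rightarrow> (nat \<times> nat) multiset) \<times> (nat \<Rightarrow> 'w \<Rightarrow> nat \<Rightarrow> nat list \<Rightarrow> real)"

definition template_val ::
    "'w template \<Rightarrow> nat \<Rightarrow> 'w \<Rightarrow> (nat \<Rightarrow> nat \<Rightarrow> real) \<Rightarrow> nat \<Rightarrow> real" where
  "template_val = (\<lambda>(n, E, W) N \<omega> A i. \<Sum>u\<in>label_lists N n. W N \<omega> i u * edge_prod A (E i u))"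

text \<open>
  The third condition expresses that the graph is connected; it holds for all \<open>S\<close> so that it is
  inherited by graphs glued at a vertex. With \<open>S = {i}\<close> it bounds the number of vertices by
  the number of edges plus one.
\<close>

definition connected_edges :: "nat \<Rightarrow> nat list \<Rightarrow> (nat \<times> nat) set \<Rightarrow> bool" where
  "connected_edges i u E \<longleftrightarrow>
     E \<subseteq> {(a, b). a \<le> b} \<and> E \<subseteq> set (i # u) \<times> set (i # u) \<and>
     (\<forall>S. i \<in> S \<longrightarrow> card (set u - S) \<le> card (E - S \<times> S))"

lemma connected_edges_empty: "connected_edges i [] {}"
  by (simp add: connected_edges_def)

text \<open>The second graph is explored only after all vertices of the first have been added to
  \<open>S\<close>. As \<open>i\<close> is in \<open>S\<close>, the first graph lies inside
  \<open>?S \<times> ?S\<close>, so the edges counted for the second graph are different from those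
  counted for the first.\<close>

lemma connected_edges_join:
  assumes "connected_edges i u E" "connected_edges i v F" "finite E" "finite F"
  shows "connected_edges i (u @ v) (E \<union> F)"
  unfolding connected_edges_def
proof (intro conjI allI impI)
  fix S assume i: "i \<in> S"
  let ?S = "S \<union> set u"
  have "card (set (u @ v) - S) = card ((set u - S) \<union> (set v - ?S))"
    by (rule arg_cong[where f = card]) auto
  also have "\<dots> \<le> card (set u - S) + card (set v - ?S)" by (rule card_Un_le)
  also have "\<dots> \<le> card (E - S \<times> S) + card (F - ?S \<times> ?S)"
    using assms i unfolding connected_edges_def by (intro add_mono) auto
  also have "\<dots> = card ((E - S \<times> S) \<union> (F - ?S \<times> ?S))"
  proof (rule card_Un_disjoint[symmetric])
    have "E \<subseteq> ?S \<times> ?S" using assms(1) i by (auto simp: connected_edges_def)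
    then show "(E - S \<times> S) \<inter> (F - ?S \<times> ?S) = {}" by blast
  qed (use assms in auto)
  also have "\<dots> \<le> card (E \<union> F - S \<times> S)"
    using assms by (intro card_mono) auto
  finally show "card (set (u @ v) - S) \<le> card (E \<union> F - S \<times> S)" .
qed (use assms in \<open>auto simp: connected_edges_def\<close>)

text \<open>If the old root \<open>j\<close> lies outside \<open>S\<close>, the new edge pays for it
  and the old graph is explored from \<open>insert j S\<close>; otherwise the old graph is explored
  from \<open>S\<close> itself.\<close>

lemma connected_edges_extend:
  assumes "connected_edges j u E" "finite E"
  shows "connected_edges i (j # u) (insert (edge i j) E)"
  unfolding connected_edges_def
proof (intro conjI allI impI)
  fix S assume i: "i \<in> S"
  show "card (set (j # u) - S) \<le> card (insert (edge i j) E - S \<times> S)"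
  proof (cases "j \<in> S")
    case True
    then have "card (set (j # u) - S) = card (set u - S)"
      by (intro arg_cong[where f = card]) auto
    also have "\<dots> \<le> card (E - S \<times> S)" using assms True by (auto simp: connected_edges_def)
    also have "\<dots> \<le> card (insert (edge i j) E - S \<times> S)" using assms by (intro card_mono) auto
    finally show ?thesis .
  next
    case False
    let ?S = "insert j S"
    have e: "edge i j \<notin> S \<times> S" "edge i j \<in> ?S \<times> ?S"
      using i False by (auto simp: edge_def min_def max_def)
    have "set (j # u) - S = insert j (set u - ?S)" using False by auto
    then have "card (set (j # u) - S) = Suc (card (set u - ?S))" by simp
    also have "\<dots> \<le> Suc (card (E - ?S \<times> ?S))" using assms by (auto simp: connected_edges_def)
    also have "\<dots> = card (insert (edge i j) (E - ?S \<times> ?S))" using assms e by simp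
    also have "\<dots> \<le> card (insert (edge i j) E - S \<times> S)"
      using assms e by (intro card_mono) auto
    finally show ?thesis .
  qed
qed (use assms in \<open>auto simp: connected_edges_def edge_def min_def max_def\<close>)

lemma connected_edges_card:
  assumes "connected_edges i u E" "finite E"
  shows "card (set (i # u)) \<le> Suc (card E)"
proof -
  have "card (set (i # u)) = Suc (card (set u - {i}))" by (simp add: card.insert_remove)
  also have "card (set u - {i}) \<le> card (E - {i} \<times> {i})"
    using assms(1) unfolding connected_edges_def by blast
  also have "card (E - {i} \<times> {i}) \<le> card E" using assms(2) by (intro card_mono) auto
  finally show ?thesis by simp
qed

text \<open>\<open>h\<close> measures the size of the environment at a vertex and will be
  \<open>1 + norm (x0 N \<omega> v)\<close>. Values of at least 1 allow a bound that involves some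
  vertices of a tree to be enlarged to one that involves all of them.\<close>

locale vertex_growth =
  fixes H :: "nat \<Rightarrow> 'w measure" and h :: "nat \<Rightarrow> 'w \<Rightarrow> nat \<Rightarrow> real"
  assumes h_ge_1: "h N \<omega> v \<ge> 1"
    and measurable_h: "N \<ge> 1 \<Longrightarrow> v \<in> {1..N} \<Longrightarrow> (\<lambda>\<omega>. h N \<omega> v) \<in> borel_measurable (H N)"
begin

definition weight :: "(nat \<Rightarrow> 'w \<Rightarrow> nat \<Rightarrow> real) \<Rightarrow> bool" where
  "weight g \<longleftrightarrow> (\<exists>K k. K \<ge> 0 \<and> (\<forall>N\<ge>1. \<forall>i\<in>{1..N}.
     (\<forall>\<omega>\<in>space (H N). \<bar>g N \<omega> i\<bar> \<le> K * h N \<omega> i ^ k) \<and>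
     (\<lambda>\<omega>. g N \<omega> i) \<in> borel_measurable (H N)))"

text \<open>One exponent serves all vertices, and it is independent of \<open>N\<close> like
  \<open>K\<close>; the bound is then a product of values of the single function
  \<open>h N \<omega> v ^ k\<close> along the list, as required for the count of labellings.\<close>

definition bounded_weight :: "nat \<Rightarrow> (nat \<Rightarrow> 'w \<Rightarrow> nat \<Rightarrow> nat list \<Rightarrow> real) \<Rightarrow> bool" where
  "bounded_weight n W \<longleftrightarrow> (\<exists>K k. K \<ge> 0 \<and> (\<forall>N\<ge>1. \<forall>i\<in>{1..N}. \<forall>u\<in>label_lists N n.
     (\<forall>\<omega>\<in>space (H N). \<bar>W N \<omega> i u\<bar> \<le> K * (\<Prod>v\<leftarrow>i # u. h N \<omega> v ^ k)) \<and>
     (\<lambda>\<omega>. W N \<omega> i u) \<in> borel_measurable (H N)))"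

text \<open>The number of edges and the connectedness refer to arbitrary lists of length
  \<open>n\<close>, with any labels, and so hold for every \<open>N\<close> with one and the same
  \<open>m\<close>.\<close>

definition valid_template :: "'w template \<Rightarrow> bool" where
  "valid_template = (\<lambda>(n, E, W).
     (\<exists>m. \<forall>i u. length u = n \<longrightarrow> size (E i u) = m) \<and>
     (\<forall>i u. length u = n \<longrightarrow> connected_edges i u (set_mset (E i u))) \<and>
     bounded_weight n W)"

definition vertex_template :: "(nat \<Rightarrow> 'w \<Rightarrow> nat \<Rightarrow> real) \<Rightarrow> 'w template" where
  "vertex_template g = (0, \<lambda>_ _. {#}, \<lambda>N \<omega> i _. g N \<omega> i)"

text \<open>This realises multiplication of functions of the root label: the two trees share the
  root \<open>i\<close>, and their other vertices are labelled independently.\<close>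

definition join_template :: "'w template \<Rightarrow> 'w template \<Rightarrow> 'w template" where
  "join_template = (\<lambda>(n, E, W) (n', E', W').
     (n + n', \<lambda>i u. E i (take n u) + E' i (drop n u),
      \<lambda>N \<omega> i u. W N \<omega> i (take n u) * W' N \<omega> i (drop n u)))"

text \<open>This realises one application of the matrix: the old root \<open>hd u\<close> becomes a
  neighbour of a new root \<open>i\<close>. Multiplicity \<open>r = 1\<close> will occur for the
  first sum of the recursion and \<open>r = 2\<close> for the squared entries of the memory
  term.\<close>

definition extend_template :: "nat \<Rightarrow> 'w template \<Rightarrow> 'w template" where
  "extend_template r = (\<lambda>(n, E, W).
     (Suc n, \<lambda>i u. replicate_mset r (edge i (hd u)) + E (hd u) (tl u),
      \<lambda>N \<omega> i u. W N \<omega> (hd u) (tl u)))"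

lemma valid_vertex_template: "weight g \<Longrightarrow> valid_template (vertex_template g)"
  by (simp add: valid_template_def vertex_template_def weight_def bounded_weight_def
      connected_edges_empty)

lemma template_val_vertex: "template_val (vertex_template g) N \<omega> A i = g N \<omega> i"
  by (simp add: template_val_def vertex_template_def)

lemma prod_list_power_add:
  "(\<Prod>v\<leftarrow>w. a v ^ (k + l)) = (\<Prod>v\<leftarrow>w. a v ^ k) * (\<Prod>v\<leftarrow>w. (a v :: real) ^ l)"
  by (induction w) (simp_all add: power_add mult_ac)

lemma prod_list_h_ge_1: "(\<Prod>v\<leftarrow>w. h N \<omega> v ^ k) \<ge> 1"
proof (induction w)
  case (Cons v w)
  have "1 * 1 \<le> h N \<omega> v ^ k * (\<Prod>v\<leftarrow>w. h N \<omega> v ^ k)"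
    using Cons h_ge_1[of N \<omega> v] by (intro mult_mono) auto
  then show ?case by simp
qed simp

lemma bounded_weight_join:
  assumes "bounded_weight n W" "bounded_weight n' W'"
  shows "bounded_weight (n + n') (\<lambda>N \<omega> i u. W N \<omega> i (take n u) * W' N \<omega> i (drop n u))"
proof -
  obtain K k where W: "K \<ge> 0" "\<And>N i u. N \<ge> 1 \<Longrightarrow> i \<in> {1..N} \<Longrightarrow> u \<in> label_lists N n \<Longrightarrow>
      (\<forall>\<omega>\<in>space (H N). \<bar>W N \<omega> i u\<bar> \<le> K * (\<Prod>v\<leftarrow>i # u. h N \<omega> v ^ k)) \<and>
      (\<lambda>\<omega>. W N \<omega> i u) \<in> borel_measurable (H N)"
    using assms(1) unfolding bounded_weight_def by blast
  obtain K' k' where W': "K' \<ge> 0" "\<And>N i u. N \<ge> 1 \<Longrightarrow> i \<in> {1..N} \<Longrightarrow> u \<in> label_lists N n' \<Longrightarrow>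
      (\<forall>\<omega>\<in>space (H N). \<bar>W' N \<omega> i u\<bar> \<le> K' * (\<Prod>v\<leftarrow>i # u. h N \<omega> v ^ k')) \<and>
      (\<lambda>\<omega>. W' N \<omega> i u) \<in> borel_measurable (H N)"
    using assms(2) unfolding bounded_weight_def by blast
  show ?thesis
    unfolding bounded_weight_def
  proof (intro exI[of _ "K * K'"] exI[of _ "k + k'"] conjI allI impI ballI)
    show "0 \<le> K * K'" using W(1) W'(1) by simp
    fix N i u assume N: "(1::nat) \<le> N" and i: "i \<in> {1..N}" and "u \<in> label_lists N (n + n')"
    then have u: "take n u \<in> label_lists N n" "drop n u \<in> label_lists N n'"
      using set_take_subset[of n u] set_drop_subset[of n u] by (auto simp: label_lists_def)
    show "(\<lambda>\<omega>. W N \<omega> i (take n u) * W' N \<omega> i (drop n u)) \<in> borel_measurable (H N)"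
      using W(2)[OF N i u(1)] W'(2)[OF N i u(2)] by (intro borel_measurable_times) auto
    fix \<omega> assume \<omega>: "\<omega> \<in> space (H N)"
    let ?P = "\<lambda>k w. \<Prod>v\<leftarrow>w. h N \<omega> v ^ k"
    have P1: "1 \<le> ?P k w" for k w by (rule prod_list_h_ge_1)
    have P0: "0 \<le> ?P k w" for k w using P1[where k = k and w = w] by linarith
    have split: "?P k u = ?P k (take n u) * ?P k (drop n u)" for k
      by (metis append_take_drop_id map_append prod_list.append)
    \<comment> \<open>The labels that one factor does not see contribute values of at least 1, so
      each of the two bounds extends to the whole list; after that the exponents add.\<close>
    have "?P k (i # take n u) * 1 \<le> ?P k (i # take n u) * ?P k (drop n u)"
      by (intro mult_left_mono P1 P0)
    also have "\<dots> = ?P k (i # u)" by (simp add: split)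
    finally have 1: "?P k (i # take n u) \<le> ?P k (i # u)" by simp
    have "1 * ?P k' (i # drop n u) \<le> ?P k' (take n u) * ?P k' (i # drop n u)"
      by (intro mult_right_mono P1 P0)
    also have "\<dots> = ?P k' (i # u)" by (simp add: split)
    finally have 2: "?P k' (i # drop n u) \<le> ?P k' (i # u)" by simp
    have "\<bar>W N \<omega> i (take n u) * W' N \<omega> i (drop n u)\<bar> \<le>
        (K * ?P k (i # take n u)) * (K' * ?P k' (i # drop n u))"
      unfolding abs_mult using W(2)[OF N i u(1)] W'(2)[OF N i u(2)] \<omega> W(1)
      by (intro mult_mono mult_nonneg_nonneg P0) auto
    also have "\<dots> \<le> (K * ?P k (i # u)) * (K' * ?P k' (i # u))"
      using W(1) W'(1) 1 2 by (intro mult_mono mult_nonneg_nonneg mult_left_mono P0) auto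
    also have "\<dots> = K * K' * ?P (k + k') (i # u)"
      unfolding prod_list_power_add by simp
    finally show "\<bar>W N \<omega> i (take n u) * W' N \<omega> i (drop n u)\<bar> \<le> K * K' * ?P (k + k') (i # u)" .
  qed
qed

lemma bounded_weight_extend:
  assumes "bounded_weight n W"
  shows "bounded_weight (Suc n) (\<lambda>N \<omega> i u. W N \<omega> (hd u) (tl u))"
proof -
  obtain K k where W: "K \<ge> 0" "\<And>N i u. N \<ge> 1 \<Longrightarrow> i \<in> {1..N} \<Longrightarrow> u \<in> label_lists N n \<Longrightarrow>
      (\<forall>\<omega>\<in>space (H N). \<bar>W N \<omega> i u\<bar> \<le> K * (\<Prod>v\<leftarrow>i # u. h N \<omega> v ^ k)) \<and>
      (\<lambda>\<omega>. W N \<omega> i u) \<in> borel_measurable (H N)"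
    using assms(1) unfolding bounded_weight_def by blast
  show ?thesis
    unfolding bounded_weight_def
  proof (intro exI[of _ K] exI[of _ k] conjI allI impI ballI W(1))
    fix N i u assume N: "(1::nat) \<le> N" and i: "i \<in> {1..N}" and "u \<in> label_lists N (Suc n)"
    then have u: "hd u \<in> {1..N}" "tl u \<in> label_lists N n" and cons: "u = hd u # tl u"
      by (cases u; auto simp: label_lists_def)+
    show "(\<lambda>\<omega>. W N \<omega> (hd u) (tl u)) \<in> borel_measurable (H N)" using W(2)[OF N u] by blast
    fix \<omega> assume \<omega>: "\<omega> \<in> space (H N)"
    have "\<bar>W N \<omega> (hd u) (tl u)\<bar> \<le> K * (\<Prod>v\<leftarrow>u. h N \<omega> v ^ k)"
      using W(2)[OF N u] \<omega> cons by metis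
    also have "\<dots> \<le> K * (h N \<omega> i ^ k * (\<Prod>v\<leftarrow>u. h N \<omega> v ^ k))"
      using W(1) h_ge_1[of N \<omega> i] prod_list_h_ge_1[of N \<omega> k u]
      by (intro mult_left_mono) (auto simp: mult_le_cancel_right1)
    finally show "\<bar>W N \<omega> (hd u) (tl u)\<bar> \<le> K * (\<Prod>v\<leftarrow>i # u. h N \<omega> v ^ k)" by simp
  qed
qed

lemma valid_join_template:
  assumes "valid_template T" "valid_template T'"
  shows "valid_template (join_template T T')"
proof -
  obtain n E W n' E' W' where T: "T = (n, E, W)" "T' = (n', E', W')" by (metis prod_cases3)
  obtain m m' where m: "\<And>i u. length u = n \<Longrightarrow> size (E i u) = m"
      "\<And>i u. length u = n' \<Longrightarrow> size (E' i u) = m'"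
    using assms T by (auto simp: valid_template_def)
  have c: "connected_edges i u (set_mset (E i u))" if "length u = n" for i u
    using assms T that by (auto simp: valid_template_def)
  have c': "connected_edges i u (set_mset (E' i u))" if "length u = n'" for i u
    using assms T that by (auto simp: valid_template_def)
  have "connected_edges i u (set_mset (E i (take n u) + E' i (drop n u)))"
    if "length u = n + n'" for i u
    using connected_edges_join[OF c[of "take n u" i] c'[of "drop n u" i]] that by simp
  moreover have "bounded_weight (n + n') (\<lambda>N \<omega> i u. W N \<omega> i (take n u) * W' N \<omega> i (drop n u))"
    using assms T by (intro bounded_weight_join) (auto simp: valid_template_def)
  ultimately show ?thesis
    using m by (auto simp: T valid_template_def join_template_def intro!: exI[of _ "m + m'"])
qed

lemma template_val_join:
  "template_val (join_template T T') N \<omega> A i = template_val T N \<omega> A i * template_val T' N \<omega> A i"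
proof -
  obtain n E W n' E' W' where T: "T = (n, E, W)" "T' = (n', E', W')" by (metis prod_cases3)
  have "template_val (join_template T T') N \<omega> A i =
      (\<Sum>u\<in>label_lists N n. \<Sum>v\<in>label_lists N n'.
        (W N \<omega> i u * edge_prod A (E i u)) * (W' N \<omega> i v * edge_prod A (E' i v)))"
    unfolding template_val_def join_template_def T prod.case sum_label_lists_append
    by (intro sum.cong refl) (auto simp: label_lists_def)
  then show ?thesis
    by (simp add: T template_val_def sum_product)
qed

lemma valid_extend_template:
  assumes "valid_template T" "r \<ge> 1"
  shows "valid_template (extend_template r T)"
proof -
  obtain n E W where T: "T = (n, E, W)" by (metis prod_cases3)
  obtain m where m: "\<And>i u. length u = n \<Longrightarrow> size (E i u) = m"
    using assms T by (auto simp: valid_template_def)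
  have c: "connected_edges i u (set_mset (E i u))" if "length u = n" for i u
    using assms T that by (auto simp: valid_template_def)
  have "connected_edges i u (set_mset (replicate_mset r (edge i (hd u)) + E (hd u) (tl u)))"
    if "length u = Suc n" for i u
    using connected_edges_extend[OF c[of "tl u" "hd u"], of i] that assms(2) by (cases u) auto
  moreover have "bounded_weight (Suc n) (\<lambda>N \<omega> i u. W N \<omega> (hd u) (tl u))"
    using assms T by (intro bounded_weight_extend) (auto simp: valid_template_def)
  ultimately show ?thesis
    using m by (auto simp: T valid_template_def extend_template_def intro!: exI[of _ "r + m"])
qed

lemma template_val_extend:
  assumes "\<And>i j. i \<in> {1..N} \<Longrightarrow> j \<in> {1..N} \<Longrightarrow> A i j = A j i" "i \<in> {1..N}"
  shows "template_val (extend_template r T) N \<omega> A i = (\<Sum>j=1..N. A i j ^ r * template_val T N \<omega> A j)"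
proof -
  obtain n E W where T: "T = (n, E, W)" by (metis prod_cases3)
  have "template_val (extend_template r T) N \<omega> A i = (\<Sum>j=1..N. \<Sum>u\<in>label_lists N n.
      W N \<omega> j u * (edge_prod A (replicate_mset r (edge i j)) * edge_prod A (E j u)))"
    by (simp add: T template_val_def extend_template_def sum_label_lists_Suc)
  also have "\<dots> = (\<Sum>j=1..N. \<Sum>u\<in>label_lists N n. W N \<omega> j u * (A i j ^ r * edge_prod A (E j u)))"
    using edge_prod_edge[of N A, OF assms(1)] assms(2) by (intro sum.cong) auto
  finally show ?thesis
    by (simp add: T template_val_def sum_distrib_left mult_ac)
qed

text \<open>The matrix is an argument here and not a random variable. A single list
  \<open>Ts\<close>, chosen before \<open>N\<close>, \<open>\<omega>\<close> and \<open>A\<close>,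
  therefore serves both ensembles and the whole sequence, and a limit can be taken template by
  template.\<close>

definition expandable :: "(nat \<Rightarrow> 'w \<Rightarrow> (nat \<Rightarrow> nat \<Rightarrow> real) \<Rightarrow> nat \<Rightarrow> real) \<Rightarrow> bool" where
  "expandable F \<longleftrightarrow> (\<exists>Ts. (\<forall>T\<in>set Ts. valid_template T) \<and>
     (\<forall>N\<ge>1. \<forall>\<omega> A. (\<forall>i\<in>{1..N}. \<forall>j\<in>{1..N}. A i j = A j i) \<longrightarrow>
        (\<forall>i\<in>{1..N}. F N \<omega> A i = (\<Sum>T\<leftarrow>Ts. template_val T N \<omega> A i))))"

lemma expandable_weight:
  assumes "weight g" shows "expandable (\<lambda>N \<omega> A i. g N \<omega> i)"
  unfolding expandable_def using valid_vertex_template[OF assms]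
  by (intro exI[of _ "[vertex_template g]"]) (simp add: template_val_vertex)

lemma expandable_add:
  assumes "expandable F" "expandable G" shows "expandable (\<lambda>N \<omega> A i. F N \<omega> A i + G N \<omega> A i)"
proof -
  from assms obtain Ts Us where
    "\<forall>T\<in>set Ts. valid_template T" "\<forall>T\<in>set Us. valid_template T"
    "\<forall>N\<ge>1. \<forall>\<omega> A. (\<forall>i\<in>{1..N}. \<forall>j\<in>{1..N}. A i j = A j i) \<longrightarrow>
        (\<forall>i\<in>{1..N}. F N \<omega> A i = (\<Sum>T\<leftarrow>Ts. template_val T N \<omega> A i))"
    "\<forall>N\<ge>1. \<forall>\<omega> A. (\<forall>i\<in>{1..N}. \<forall>j\<in>{1..N}. A i j = A j i) \<longrightarrow>
        (\<forall>i\<in>{1..N}. G N \<omega> A i = (\<Sum>T\<leftarrow>Us. template_val T N \<omega> A i))"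
    unfolding expandable_def by blast
  then show ?thesis
    unfolding expandable_def by (intro exI[of _ "Ts @ Us"]) auto
qed

lemma expandable_mult:
  assumes "expandable F" "expandable G" shows "expandable (\<lambda>N \<omega> A i. F N \<omega> A i * G N \<omega> A i)"
proof -
  from assms obtain Ts Us where *:
    "\<forall>T\<in>set Ts. valid_template T" "\<forall>T\<in>set Us. valid_template T"
    "\<forall>N\<ge>1. \<forall>\<omega> A. (\<forall>i\<in>{1..N}. \<forall>j\<in>{1..N}. A i j = A j i) \<longrightarrow>
        (\<forall>i\<in>{1..N}. F N \<omega> A i = (\<Sum>T\<leftarrow>Ts. template_val T N \<omega> A i))"
    "\<forall>N\<ge>1. \<forall>\<omega> A. (\<forall>i\<in>{1..N}. \<forall>j\<in>{1..N}. A i j = A j i) \<longrightarrow>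
        (\<forall>i\<in>{1..N}. G N \<omega> A i = (\<Sum>T\<leftarrow>Us. template_val T N \<omega> A i))"
    unfolding expandable_def by blast
  have "(\<Sum>T\<leftarrow>concat (map (\<lambda>T. map (join_template T) Us) Ts'). template_val T N \<omega> A i) =
      (\<Sum>T\<leftarrow>Ts'. template_val T N \<omega> A i) * (\<Sum>T\<leftarrow>Us. template_val T N \<omega> A i)" for Ts' N \<omega> A i
    by (induction Ts') (simp_all add: comp_def template_val_join sum_list_const_mult distrib_right)
  with * show ?thesis
    unfolding expandable_def
    by (intro exI[of _ "concat (map (\<lambda>T. map (join_template T) Us) Ts)"])
      (auto intro: valid_join_template)
qed

lemma expandable_matrix_sum:
  assumes "expandable F" "r \<ge> 1"
  shows "expandable (\<lambda>N \<omega> A i. \<Sum>j=1..N. A i j ^ r * F N \<omega> A j)"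
proof -
  from assms obtain Ts where *:
    "\<forall>T\<in>set Ts. valid_template T"
    "\<forall>N\<ge>1. \<forall>\<omega> A. (\<forall>i\<in>{1..N}. \<forall>j\<in>{1..N}. A i j = A j i) \<longrightarrow>
        (\<forall>i\<in>{1..N}. F N \<omega> A i = (\<Sum>T\<leftarrow>Ts. template_val T N \<omega> A i))"
    unfolding expandable_def by blast
  show ?thesis
    unfolding expandable_def
  proof (intro exI[of _ "map (extend_template r) Ts"] conjI allI impI ballI)
    fix N :: nat and \<omega> and A :: "nat \<Rightarrow> nat \<Rightarrow> real" and i
    assume N: "N \<ge> 1" and A: "\<forall>i\<in>{1..N}. \<forall>j\<in>{1..N}. A i j = A j i" and i: "i \<in> {1..N}"
    have extend: "template_val (extend_template r T) N \<omega> A i =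
        (\<Sum>j=1..N. A i j ^ r * template_val T N \<omega> A j)" for T
      using A i by (intro template_val_extend) auto
    have "(\<Sum>T\<leftarrow>map (extend_template r) Ts'. template_val T N \<omega> A i) =
        (\<Sum>j=1..N. A i j ^ r * (\<Sum>T\<leftarrow>Ts'. template_val T N \<omega> A j))" for Ts'
      by (induction Ts') (simp_all add: extend distrib_left sum.distrib)
    then show "(\<Sum>j=1..N. A i j ^ r * F N \<omega> A j) =
        (\<Sum>T\<leftarrow>map (extend_template r) Ts. template_val T N \<omega> A i)"
      using * N A by simp
  next
    fix T assume "T \<in> set (map (extend_template r) Ts)"
    then obtain U where "U \<in> set Ts" "T = extend_template r U" by (auto simp del: split_paired_Ex)
    then show "valid_template T" using *(1) assms(2) by (simp add: valid_extend_template)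
  qed
qed

lemma weight_const: "weight (\<lambda>_ _ _. b)"
  unfolding weight_def by (intro exI[of _ "\<bar>b\<bar>"] exI[of _ 0]) auto

lemma expandable_const: "expandable (\<lambda>_ _ _ _. b)"
  using expandable_weight[OF weight_const] .

lemma expandable_sum:
  assumes "finite I" "\<And>k. k \<in> I \<Longrightarrow> expandable (F k)"
  shows "expandable (\<lambda>N \<omega> A i. \<Sum>k\<in>I. F k N \<omega> A i)"
  using assms by (induction I) (auto intro: expandable_const expandable_add)

lemma expandable_prod:
  assumes "finite I" "\<And>k. k \<in> I \<Longrightarrow> expandable (F k)"
  shows "expandable (\<lambda>N \<omega> A i. \<Prod>k\<in>I. F k N \<omega> A i)"
  using assms by (induction I) (auto intro: expandable_const expandable_mult)

lemma expandable_power: "expandable F \<Longrightarrow> expandable (\<lambda>N \<omega> A i. F N \<omega> A i ^ k)"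
  by (induction k) (auto intro: expandable_const expandable_mult)

lemma expandable_diff:
  assumes "expandable F" "expandable G" shows "expandable (\<lambda>N \<omega> A i. F N \<omega> A i - G N \<omega> A i)"
  using expandable_add[OF assms(1) expandable_mult[OF expandable_const[of "- 1"] assms(2)]] by simp

end

section \<open>Comparison of two matrix ensembles\<close>

context vertex_growth
begin

text \<open>The cut-off \<open>\<phi>\<close> supplies integrability, since weights are only
  dominated by powers of \<open>h\<close>. The constants \<open>K\<close> and \<open>k\<close> are
  chosen before \<open>N\<close> and depend on the template and \<open>C\<close>. The exponent
  \<open>k\<close> is that of the weight bound times the number of vertices, because a product over
  all vertices is replaced by a power at one of them.\<close>

lemma template_difference:
  assumes "valid_template T"
  shows "\<exists>K k. K \<ge> 0 \<and> (\<forall>N M A A' \<phi>.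
    sparse_ensemble M (H N) N C A \<longrightarrow> sparse_ensemble M (H N) N C A' \<longrightarrow>
    (\<forall>(i, j)\<in>upper_pairs N. (LINT \<omega>|M. (A \<omega> i j)\<^sup>2) = (LINT \<omega>|M. (A' \<omega> i j)\<^sup>2)) \<longrightarrow>
    \<phi> \<in> borel_measurable (H N) \<longrightarrow> (\<forall>\<omega>. \<phi> \<omega> \<ge> 0) \<longrightarrow>
    (\<forall>i\<in>{1..N}. integrable M (\<lambda>\<omega>. \<phi> \<omega> * h N \<omega> i ^ k)) \<longrightarrow>
    (\<forall>i\<in>{1..N}. integrable M (\<lambda>\<omega>. \<phi> \<omega> * template_val T N \<omega> (A \<omega>) i) \<and>
       integrable M (\<lambda>\<omega>. \<phi> \<omega> * template_val T N \<omega> (A' \<omega>) i)) \<and>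
    \<bar>\<Sum>i=1..N. (LINT \<omega>|M. \<phi> \<omega> * template_val T N \<omega> (A \<omega>) i) -
        (LINT \<omega>|M. \<phi> \<omega> * template_val T N \<omega> (A' \<omega>) i)\<bar> \<le>
      K * sqrt (real N) * ((1 / real N) * (\<Sum>i=1..N. LINT \<omega>|M. \<phi> \<omega> * h N \<omega> i ^ k)))"
proof -
  obtain n E W where T: "T = (n, E, W)" by (metis prod_cases3)
  obtain m where m: "\<And>i u. length u = n \<Longrightarrow> size (E i u) = m"
    using assms T by (auto simp: valid_template_def)
  have conn: "connected_edges i u (set_mset (E i u))" if "length u = n" for i u
    using assms T that by (auto simp: valid_template_def)
  have "bounded_weight n W" using assms T by (auto simp: valid_template_def)
  then obtain L l where L: "L \<ge> 0" and W: "\<And>N i u. N \<ge> 1 \<Longrightarrow> i \<in> {1..N} \<Longrightarrow> u \<in> label_lists N n \<Longrightarrow>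
      (\<forall>\<omega>\<in>space (H N). \<bar>W N \<omega> i u\<bar> \<le> L * (\<Prod>v\<leftarrow>i # u. h N \<omega> v ^ l)) \<and>
      (\<lambda>\<omega>. W N \<omega> i u) \<in> borel_measurable (H N)"
    unfolding bounded_weight_def by blast
  \<comment> \<open>\<open>K0\<close> collects the moment constants of \<open>m\<close> edges for
    two ensembles; \<open>R\<close> is the constant of the count of labellings with
    \<open>Suc n\<close> vertices.\<close>
  define K0 where "K0 = 2 * moment_const C m ^ m"
  define R where "R = (real n + 3) ^ Suc n"
  have K0: "K0 \<ge> 0" using moment_const_ge_1[of C m] by (simp add: K0_def)
  have R: "R \<ge> 0" by (simp add: R_def)
  show ?thesis
  proof (intro exI[of _ "K0 * (L * R)"] exI[of _ "l * Suc n"] conjI allI impI)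
    show "0 \<le> K0 * (L * R)" using K0 L R by simp
  next
    fix N :: nat and M :: "'w measure" and A A' :: "'w \<Rightarrow> nat \<Rightarrow> nat \<Rightarrow> real" and \<phi> :: "'w \<Rightarrow> real"
    assume ens: "sparse_ensemble M (H N) N C A" "sparse_ensemble M (H N) N C A'"
      and var: "\<forall>(i, j)\<in>upper_pairs N. (LINT \<omega>|M. (A \<omega> i j)\<^sup>2) = (LINT \<omega>|M. (A' \<omega> i j)\<^sup>2)"
      and \<phi>: "\<phi> \<in> borel_measurable (H N)" and \<phi>0: "\<forall>\<omega>. \<phi> \<omega> \<ge> 0"
      and int: "\<forall>i\<in>{1..N}. integrable M (\<lambda>\<omega>. \<phi> \<omega> * h N \<omega> i ^ (l * Suc n))"
    interpret A: sparse_ensemble M "H N" N C A by fact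
    interpret A': sparse_ensemble M "H N" N C A' by fact
    have N: "N \<ge> 1" by (rule A.N_ge_1)
    have sub: "f \<in> borel_measurable M" if "f \<in> borel_measurable (H N)" for f :: "'w \<Rightarrow> real"
      using that A.indep_setD_ev1[OF A.indep_H] A.space_H by (auto simp: measurable_def)
    define P where "P w \<omega> = (\<Prod>v\<leftarrow>w. h N \<omega> v ^ l)" for w \<omega>
    \<comment> \<open>With \<open>\<phi>\<close> included, the weight is still measurable with
      respect to \<open>H N\<close> and hence independent of either matrix. Indexing by the list
      \<open>i # u\<close> treats the root like any other vertex.\<close>
    define Z where "Z w \<omega> = \<phi> \<omega> * W N \<omega> (hd w) (tl w)" for w \<omega>
    have P1: "P w \<omega> \<ge> 1" for w \<omega> unfolding P_def by (rule prod_list_h_ge_1)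
    have P_meas: "P w \<in> borel_measurable (H N)" if "set w \<subseteq> {1..N}" for w
      using that unfolding P_def
    proof (induction w)
      case (Cons v w)
      then have "(\<lambda>\<omega>. h N \<omega> v ^ l) \<in> borel_measurable (H N)"
        using measurable_h[OF N, of v] by (intro borel_measurable_power) auto
      with Cons show ?case by (auto intro: borel_measurable_times)
    qed simp
    have P_le: "P w \<omega> \<le> (\<Sum>v=1..N. h N \<omega> v ^ (l * Suc n))" if "w \<in> label_lists N (Suc n)" for w \<omega>
    proof -
      have "w \<noteq> []" "length w = Suc n" "set w \<subseteq> {1..N}" using that by (auto simp: label_lists_def)
      moreover have "1 \<le> h N \<omega> v ^ l" for v using h_ge_1[of N \<omega> v] by simp
      ultimately have "P w \<omega> \<le> (\<Sum>v\<in>set w. (h N \<omega> v ^ l) ^ Suc n)"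
        unfolding P_def using prod_list_le_sum_power[of "\<lambda>v. h N \<omega> v ^ l" w] by metis
      also have "\<dots> \<le> (\<Sum>v=1..N. (h N \<omega> v ^ l) ^ Suc n)"
        using \<open>set w \<subseteq> {1..N}\<close> order_trans[OF zero_le_one h_ge_1]
        by (intro sum_mono2) (auto simp del: power_Suc)
      finally show ?thesis by (simp only: power_mult)
    qed
    have int_P: "integrable M (\<lambda>\<omega>. \<phi> \<omega> * P w \<omega>)" if w: "w \<in> label_lists N (Suc n)" for w
    proof (rule Bochner_Integration.integrable_bound)
      show "integrable M (\<lambda>\<omega>. \<Sum>v=1..N. \<phi> \<omega> * h N \<omega> v ^ (l * Suc n))"
        using int by (intro Bochner_Integration.integrable_sum) blast
      show "(\<lambda>\<omega>. \<phi> \<omega> * P w \<omega>) \<in> borel_measurable M"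
        using w by (intro sub borel_measurable_times \<phi> P_meas) (auto simp: label_lists_def)
      show "AE \<omega> in M. norm (\<phi> \<omega> * P w \<omega>) \<le> norm (\<Sum>v=1..N. \<phi> \<omega> * h N \<omega> v ^ (l * Suc n))"
      proof (rule AE_I2)
        fix \<omega>
        have "norm (\<phi> \<omega> * P w \<omega>) = \<phi> \<omega> * P w \<omega>"
          using \<phi>0 P1[of w \<omega>] by (simp add: abs_mult)
        also have "\<dots> \<le> \<phi> \<omega> * (\<Sum>v=1..N. h N \<omega> v ^ (l * Suc n))"
          using \<phi>0 P_le[OF w] by (intro mult_left_mono) auto
        also have "\<dots> \<le> norm (\<Sum>v=1..N. \<phi> \<omega> * h N \<omega> v ^ (l * Suc n))"
          unfolding sum_distrib_left by simp
        finally show "norm (\<phi> \<omega> * P w \<omega>) \<le> norm (\<Sum>v=1..N. \<phi> \<omega> * h N \<omega> v ^ (l * Suc n))" .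
      qed
    qed
    have Z: "Z w \<in> borel_measurable (H N)" "integrable M (Z w)"
      "(LINT \<omega>|M. \<bar>Z w \<omega>\<bar>) \<le> L * (LINT \<omega>|M. \<phi> \<omega> * P w \<omega>)" if w: "w \<in> label_lists N (Suc n)" for w
    proof -
      obtain i u where iu: "w = i # u" "i \<in> {1..N}" "u \<in> label_lists N n"
        using w by (cases w) (auto simp: label_lists_def)
      show meas: "Z w \<in> borel_measurable (H N)"
        unfolding Z_def using W[OF N iu(2,3)] \<phi> iu(1) by (intro borel_measurable_times) auto
      have le: "\<bar>Z w \<omega>\<bar> \<le> L * (\<phi> \<omega> * P w \<omega>)" if "\<omega> \<in> space M" for \<omega>
      proof -
        have "\<bar>Z w \<omega>\<bar> = \<phi> \<omega> * \<bar>W N \<omega> i u\<bar>" using \<phi>0 iu by (simp add: Z_def abs_mult)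
        also have "\<dots> \<le> \<phi> \<omega> * (L * P w \<omega>)"
          using W[OF N iu(2,3)] that \<phi>0 A.space_H unfolding P_def iu(1) by (intro mult_left_mono) auto
        finally show ?thesis by (simp add: mult_ac)
      qed
      have int_LP: "integrable M (\<lambda>\<omega>. L * (\<phi> \<omega> * P w \<omega>))"
        using int_P[OF w] by simp
      show int_Z: "integrable M (Z w)"
        by (rule Bochner_Integration.integrable_bound[OF int_LP sub[OF meas]])
          (auto intro!: AE_I2 order_trans[OF le abs_ge_self])
      have "(LINT \<omega>|M. \<bar>Z w \<omega>\<bar>) \<le> (LINT \<omega>|M. L * (\<phi> \<omega> * P w \<omega>))"
        by (intro integral_mono int_LP integrable_abs int_Z le)
      then show "(LINT \<omega>|M. \<bar>Z w \<omega>\<bar>) \<le> L * (LINT \<omega>|M. \<phi> \<omega> * P w \<omega>)" by simp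
    qed
    have E: "1 \<le> a \<and> a \<le> b \<and> b \<le> N"
      if "i \<in> {1..N}" "u \<in> label_lists N n" "(a, b) \<in># E i u" for i u a b
      using that conn[of u i] unfolding connected_edges_def label_lists_def by fastforce
    have Cons: "i # u \<in> label_lists N (Suc n)" if "i \<in> {1..N}" "u \<in> label_lists N n" for i u
      using that by (auto simp: label_lists_def)
    have tv: "(\<lambda>\<omega>. \<phi> \<omega> * template_val T N \<omega> (B \<omega>) i) =
        (\<lambda>\<omega>. \<Sum>u\<in>label_lists N n. Z (i # u) \<omega> * edge_prod (B \<omega>) (E i u))" for B i
      by (rule ext) (simp add: T template_val_def Z_def sum_distrib_left mult_ac)
    have int_t: "integrable M (\<lambda>\<omega>. Z (i # u) \<omega> * edge_prod (A \<omega>) (E i u))"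
        "integrable M (\<lambda>\<omega>. Z (i # u) \<omega> * edge_prod (A' \<omega>) (E i u))"
      if "i \<in> {1..N}" "u \<in> label_lists N n" for i u
      using A.weighted_edge_prod(1)[OF Z(1,2)[OF Cons[OF that]], of "E i u"]
        A'.weighted_edge_prod(1)[OF Z(1,2)[OF Cons[OF that]], of "E i u"] E[OF that] by auto
    show "\<forall>i\<in>{1..N}. integrable M (\<lambda>\<omega>. \<phi> \<omega> * template_val T N \<omega> (A \<omega>) i) \<and>
       integrable M (\<lambda>\<omega>. \<phi> \<omega> * template_val T N \<omega> (A' \<omega>) i)"
      unfolding tv using int_t by (auto intro!: Bochner_Integration.integrable_sum)
    let ?d = "\<lambda>i u. (LINT \<omega>|M. Z (i # u) \<omega> * edge_prod (A \<omega>) (E i u)) -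
      (LINT \<omega>|M. Z (i # u) \<omega> * edge_prod (A' \<omega>) (E i u))"
    have d_le: "\<bar>?d i u\<bar> \<le> K0 * sqrt (real N) *
        (L * ((LINT \<omega>|M. \<phi> \<omega> * P (i # u) \<omega>) / real N ^ card (set (i # u))))"
      if iu: "i \<in> {1..N}" "u \<in> label_lists N n" for i u
    proof -
      have len: "length u = n" using iu by (simp add: label_lists_def)
      have "\<bar>?d i u\<bar> \<le> K0 * sqrt (real N) * ((LINT \<omega>|M. \<bar>Z (i # u) \<omega>\<bar>) / real N ^ card (set (i # u)))"
        unfolding K0_def m[OF len, of i, symmetric]
        using connected_edges_card[OF conn[OF len, of i]] var
        by (intro weighted_edge_prod_diff[OF ens] Z Cons iu E[OF iu]) auto
      also have "\<dots> \<le> K0 * sqrt (real N) *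
          ((L * (LINT \<omega>|M. \<phi> \<omega> * P (i # u) \<omega>)) / real N ^ card (set (i # u)))"
        using K0 by (intro mult_left_mono divide_right_mono Z Cons iu) auto
      finally show ?thesis by simp
    qed
    \<comment> \<open>With the sum moved inside the expectation, the count of labellings applies for
      each \<open>\<omega>\<close> separately, to the random values
      \<open>h N \<omega> v ^ l\<close>.\<close>
    have "(\<Sum>w\<in>label_lists N (Suc n). (LINT \<omega>|M. \<phi> \<omega> * P w \<omega>) / real N ^ card (set w)) =
        (LINT \<omega>|M. (\<Sum>w\<in>label_lists N (Suc n). \<phi> \<omega> * P w \<omega> / real N ^ card (set w)))"
      using int_P by (subst Bochner_Integration.integral_sum) auto
    also have "\<dots> \<le> (LINT \<omega>|M. R * ((1 / real N) * (\<Sum>v=1..N. \<phi> \<omega> * h N \<omega> v ^ (l * Suc n))))"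
    proof (rule integral_mono)
      show "integrable M (\<lambda>\<omega>. \<Sum>w\<in>label_lists N (Suc n). \<phi> \<omega> * P w \<omega> / real N ^ card (set w))"
        using int_P by (intro Bochner_Integration.integrable_sum) auto
      show "integrable M (\<lambda>\<omega>. R * ((1 / real N) * (\<Sum>v=1..N. \<phi> \<omega> * h N \<omega> v ^ (l * Suc n))))"
        using int by (intro integrable_mult_right Bochner_Integration.integrable_sum) auto
      fix \<omega>
      have "1 \<le> h N \<omega> v ^ l" for v using h_ge_1[of N \<omega> v] by simp
      then have "(\<Sum>w\<in>label_lists N (Suc n). P w \<omega> / real N ^ card (set w)) \<le>
          R * ((1 / real N) * (\<Sum>v=1..N. h N \<omega> v ^ (l * Suc n)))"
        using sum_prod_list_card_le[OF N, of "\<lambda>v. h N \<omega> v ^ l" n]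
        unfolding P_def R_def power_mult by blast
      then have "\<phi> \<omega> * (\<Sum>w\<in>label_lists N (Suc n). P w \<omega> / real N ^ card (set w)) \<le>
          \<phi> \<omega> * (R * ((1 / real N) * (\<Sum>v=1..N. h N \<omega> v ^ (l * Suc n))))"
        using \<phi>0 by (intro mult_left_mono) auto
      then show "(\<Sum>w\<in>label_lists N (Suc n). \<phi> \<omega> * P w \<omega> / real N ^ card (set w)) \<le>
          R * ((1 / real N) * (\<Sum>v=1..N. \<phi> \<omega> * h N \<omega> v ^ (l * Suc n)))"
        by (simp only: sum_distrib_left times_divide_eq_right mult.left_commute)
    qed
    also have "\<dots> = R * ((1 / real N) * (\<Sum>v=1..N. LINT \<omega>|M. \<phi> \<omega> * h N \<omega> v ^ (l * Suc n)))"
      using int by (simp only: integral_mult_right_zero Bochner_Integration.integral_sum)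
    finally have total: "(\<Sum>w\<in>label_lists N (Suc n). (LINT \<omega>|M. \<phi> \<omega> * P w \<omega>) / real N ^ card (set w)) \<le>
        R * ((1 / real N) * (\<Sum>v=1..N. LINT \<omega>|M. \<phi> \<omega> * h N \<omega> v ^ (l * Suc n)))" .
    have "\<bar>\<Sum>i=1..N. (LINT \<omega>|M. \<phi> \<omega> * template_val T N \<omega> (A \<omega>) i) -
        (LINT \<omega>|M. \<phi> \<omega> * template_val T N \<omega> (A' \<omega>) i)\<bar> =
        \<bar>\<Sum>i=1..N. \<Sum>u\<in>label_lists N n. ?d i u\<bar>"
      unfolding tv using int_t
      by (intro arg_cong[where f = abs] sum.cong refl)
        (simp add: Bochner_Integration.integral_sum sum_subtractf)
    also have "\<dots> \<le> (\<Sum>i=1..N. \<Sum>u\<in>label_lists N n. \<bar>?d i u\<bar>)"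
      by (intro order_trans[OF sum_abs] sum_mono order_refl)
    also have "\<dots> \<le> (\<Sum>i=1..N. \<Sum>u\<in>label_lists N n. K0 * sqrt (real N) *
        (L * ((LINT \<omega>|M. \<phi> \<omega> * P (i # u) \<omega>) / real N ^ card (set (i # u)))))"
      by (intro sum_mono d_le)
    also have "\<dots> = K0 * sqrt (real N) * (L * (\<Sum>w\<in>label_lists N (Suc n).
        (LINT \<omega>|M. \<phi> \<omega> * P w \<omega>) / real N ^ card (set w)))"
      by (simp only: sum_label_lists_Suc sum_distrib_left)
    also have "\<dots> \<le> K0 * sqrt (real N) *
        (L * (R * ((1 / real N) * (\<Sum>v=1..N. LINT \<omega>|M. \<phi> \<omega> * h N \<omega> v ^ (l * Suc n)))))"
      using K0 L by (intro mult_left_mono[OF mult_left_mono[OF total]]) auto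
    finally show "\<bar>\<Sum>i=1..N. (LINT \<omega>|M. \<phi> \<omega> * template_val T N \<omega> (A \<omega>) i) -
        (LINT \<omega>|M. \<phi> \<omega> * template_val T N \<omega> (A' \<omega>) i)\<bar> \<le>
      K0 * (L * R) * sqrt (real N) *
        ((1 / real N) * (\<Sum>i=1..N. LINT \<omega>|M. \<phi> \<omega> * h N \<omega> i ^ (l * Suc n)))"
      by (simp only: mult_ac)
  qed
qed

lemma expandable_difference:
  fixes M :: "nat \<Rightarrow> 'w measure"
  assumes ens: "\<And>N. N \<ge> 1 \<Longrightarrow> sparse_ensemble (M N) (H N) N C (A N)"
      "\<And>N. N \<ge> 1 \<Longrightarrow> sparse_ensemble (M N) (H N) N C (A' N)"
    and sym: "\<And>N \<omega> i j. N \<ge> 1 \<Longrightarrow> \<omega> \<in> space (M N) \<Longrightarrow> i \<in> {1..N} \<Longrightarrow> j \<in> {1..N} \<Longrightarrow> A N \<omega> i j = A N \<omega> j i"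
      "\<And>N \<omega> i j. N \<ge> 1 \<Longrightarrow> \<omega> \<in> space (M N) \<Longrightarrow> i \<in> {1..N} \<Longrightarrow> j \<in> {1..N} \<Longrightarrow> A' N \<omega> i j = A' N \<omega> j i"
    and var: "\<And>N i j. (i, j) \<in> upper_pairs N \<Longrightarrow>
      (LINT \<omega>|M N. (A N \<omega> i j)\<^sup>2) = (LINT \<omega>|M N. (A' N \<omega> i j)\<^sup>2)"
    and \<phi>: "\<And>N. N \<ge> 1 \<Longrightarrow> \<phi> N \<in> borel_measurable (H N)" "\<And>N \<omega>. \<phi> N \<omega> \<ge> (0::real)"
    and moments: "\<And>k. \<exists>K. \<forall>\<^sub>F N in sequentially.
      (\<forall>i\<in>{1..N}. integrable (M N) (\<lambda>\<omega>. \<phi> N \<omega> * h N \<omega> i ^ k)) \<and>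
      (1 / real N) * (\<Sum>i=1..N. LINT \<omega>|M N. \<phi> N \<omega> * h N \<omega> i ^ k) \<le> K"
    and F: "expandable F"
  shows "(\<lambda>N. (1 / real N) * (\<Sum>i=1..N. (LINT \<omega>|M N. \<phi> N \<omega> * F N \<omega> (A N \<omega>) i) -
    (LINT \<omega>|M N. \<phi> N \<omega> * F N \<omega> (A' N \<omega>) i))) \<longlonglongrightarrow> 0"
proof -
  let ?I = "\<lambda>f A N i. LINT \<omega>|M N. \<phi> N \<omega> * f N \<omega> (A N \<omega>) i"
  let ?D = "\<lambda>f N. (1 / real N) * (\<Sum>i=1..N. ?I f A N i - ?I f A' N i)"
  \<comment> \<open>Integrability is carried along with the limit: the sum over templates is split
    by linearity of the integral, which would fail for non-integrable summands, whose integral is 0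
    by convention.\<close>
  let ?int = "\<lambda>f. \<forall>\<^sub>F N in sequentially. \<forall>i\<in>{1..N}.
    integrable (M N) (\<lambda>\<omega>. \<phi> N \<omega> * f N \<omega> (A N \<omega>) i) \<and>
    integrable (M N) (\<lambda>\<omega>. \<phi> N \<omega> * f N \<omega> (A' N \<omega>) i)"
  have template: "?D (template_val T) \<longlonglongrightarrow> 0 \<and> ?int (template_val T)"
    if T: "valid_template T" for T
  proof -
    obtain K k where K: "K \<ge> 0" and *: "\<And>N M A A' \<phi>.
        sparse_ensemble M (H N) N C A \<Longrightarrow> sparse_ensemble M (H N) N C A' \<Longrightarrow>
        (\<forall>(i, j)\<in>upper_pairs N. (LINT \<omega>|M. (A \<omega> i j)\<^sup>2) = (LINT \<omega>|M. (A' \<omega> i j)\<^sup>2)) \<Longrightarrow>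
        \<phi> \<in> borel_measurable (H N) \<Longrightarrow> (\<forall>\<omega>. \<phi> \<omega> \<ge> 0) \<Longrightarrow>
        (\<forall>i\<in>{1..N}. integrable M (\<lambda>\<omega>. \<phi> \<omega> * h N \<omega> i ^ k)) \<Longrightarrow>
        (\<forall>i\<in>{1..N}. integrable M (\<lambda>\<omega>. \<phi> \<omega> * template_val T N \<omega> (A \<omega>) i) \<and>
           integrable M (\<lambda>\<omega>. \<phi> \<omega> * template_val T N \<omega> (A' \<omega>) i)) \<and>
        \<bar>\<Sum>i=1..N. (LINT \<omega>|M. \<phi> \<omega> * template_val T N \<omega> (A \<omega>) i) -
            (LINT \<omega>|M. \<phi> \<omega> * template_val T N \<omega> (A' \<omega>) i)\<bar> \<le>
          K * sqrt (real N) * ((1 / real N) * (\<Sum>i=1..N. LINT \<omega>|M. \<phi> \<omega> * h N \<omega> i ^ k))"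
      using template_difference[OF T, of C] by blast
    obtain B where B: "\<forall>\<^sub>F N in sequentially.
        (\<forall>i\<in>{1..N}. integrable (M N) (\<lambda>\<omega>. \<phi> N \<omega> * h N \<omega> i ^ k)) \<and>
        (1 / real N) * (\<Sum>i=1..N. LINT \<omega>|M N. \<phi> N \<omega> * h N \<omega> i ^ k) \<le> B"
      using moments by blast
    have ev: "\<forall>\<^sub>F N in sequentially. (\<forall>i\<in>{1..N}.
        integrable (M N) (\<lambda>\<omega>. \<phi> N \<omega> * template_val T N \<omega> (A N \<omega>) i) \<and>
        integrable (M N) (\<lambda>\<omega>. \<phi> N \<omega> * template_val T N \<omega> (A' N \<omega>) i)) \<and>
        norm (?D (template_val T) N) \<le> K * B / sqrt (real N)"
      using B eventually_ge_at_top[of 1]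
    proof eventually_elim
      case (elim N)
      have var': "\<forall>(i, j)\<in>upper_pairs N. (LINT \<omega>|M N. (A N \<omega> i j)\<^sup>2) = (LINT \<omega>|M N. (A' N \<omega> i j)\<^sup>2)"
        using var by blast
      have \<phi>0: "\<forall>\<omega>. \<phi> N \<omega> \<ge> 0" using \<phi>(2) by blast
      note concl = *[OF ens[OF elim(2)] var' \<phi>(1)[OF elim(2)] \<phi>0 conjunct1[OF elim(1)]]
      have s: "sqrt (real N) > 0" "real N = sqrt (real N) * sqrt (real N)" using elim(2) by simp_all
      have "norm (?D (template_val T) N) = (1 / real N) *
          \<bar>\<Sum>i=1..N. ?I (template_val T) A N i - ?I (template_val T) A' N i\<bar>"
        by (simp add: abs_mult)
      also have "\<dots> \<le> (1 / real N) * (K * sqrt (real N) *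
          ((1 / real N) * (\<Sum>i=1..N. LINT \<omega>|M N. \<phi> N \<omega> * h N \<omega> i ^ k)))"
        by (rule mult_left_mono[OF conjunct2[OF concl]]) simp
      also have "\<dots> \<le> (1 / real N) * (K * sqrt (real N) * B)"
        using elim(1) K by (intro mult_left_mono mult_nonneg_nonneg) auto
      also have "\<dots> = K * B / sqrt (real N)"
        using s by (metis (no_types, lifting) divide_divide_eq_left mult.commute mult_1
          nonzero_mult_div_cancel_right order_less_irrefl times_divide_eq_right)
      finally show ?case using conjunct1[OF concl] by blast
    qed
    have "(\<lambda>N. K * B / sqrt (real N)) \<longlonglongrightarrow> 0"
      by (intro real_tendsto_divide_at_top[OF tendsto_const]
        filterlim_compose[OF sqrt_at_top filterlim_real_sequentially])
    then have "?D (template_val T) \<longlonglongrightarrow> 0"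
      by (rule Lim_null_comparison[rotated]) (use ev in eventually_elim, blast)
    with ev show ?thesis by (auto elim: eventually_mono)
  qed
  from F obtain Ts where Ts: "\<And>T. T \<in> set Ts \<Longrightarrow> valid_template T"
    and F_eq: "\<And>N \<omega> A i. N \<ge> 1 \<Longrightarrow> (\<And>i j. i \<in> {1..N} \<Longrightarrow> j \<in> {1..N} \<Longrightarrow> A i j = A j i) \<Longrightarrow>
        i \<in> {1..N} \<Longrightarrow> F N \<omega> A i = (\<Sum>T\<leftarrow>Ts. template_val T N \<omega> A i)"
    unfolding expandable_def by blast
  let ?S = "\<lambda>Ts N \<omega> A i. \<Sum>T\<leftarrow>Ts. template_val T N \<omega> A i"
  have "?D (?S Ts) \<longlonglongrightarrow> 0 \<and> ?int (?S Ts)"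
    using Ts
  proof (induction Ts)
    case (Cons T Ts)
    then have T: "?D (template_val T) \<longlonglongrightarrow> 0" "?int (template_val T)"
      and IH: "?D (?S Ts) \<longlonglongrightarrow> 0" "?int (?S Ts)"
      using template[of T] by auto
    have int: "?int (?S (T # Ts))"
      using T(2) IH(2) by eventually_elim (auto simp: distrib_left)
    have "\<forall>\<^sub>F N in sequentially. ?D (template_val T) N + ?D (?S Ts) N = ?D (?S (T # Ts)) N"
      using T(2) IH(2)
    proof eventually_elim
      case (elim N)
      have "?D (template_val T) N + ?D (?S Ts) N = (1 / real N) * (\<Sum>i=1..N.
          (?I (template_val T) A N i - ?I (template_val T) A' N i) + (?I (?S Ts) A N i - ?I (?S Ts) A' N i))"
        by (simp only: sum.distrib distrib_left)
      also have "\<dots> = ?D (?S (T # Ts)) N"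
        using elim by (intro arg_cong[where f = "(*) (1 / real N)"] sum.cong refl) (simp add: distrib_left)
      finally show ?case .
    qed
    then have "?D (?S (T # Ts)) \<longlonglongrightarrow> 0"
      by (rule Lim_transform_eventually[rotated]) (use tendsto_add[OF T(1) IH(1)] in simp)
    with int show ?case by blast
  qed simp
  then have lim: "?D (?S Ts) \<longlonglongrightarrow> 0" by blast
  show ?thesis
  \<comment> \<open>Symmetry of the matrices is known on \<open>space (M N)\<close>, and equality of
    the integrands there suffices for equality of the integrals.\<close>
  proof (rule Lim_transform_eventually[OF lim])
    show "\<forall>\<^sub>F N in sequentially. ?D (?S Ts) N = ?D F N"
      using eventually_ge_at_top[of 1]
    proof eventually_elim
      case (elim N)
      have "F N \<omega> (A N \<omega>) i = ?S Ts N \<omega> (A N \<omega>) i" "F N \<omega> (A' N \<omega>) i = ?S Ts N \<omega> (A' N \<omega>) i"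
        if "i \<in> {1..N}" "\<omega> \<in> space (M N)" for i \<omega>
        using F_eq[OF elim _ that(1), of "A N \<omega>"] F_eq[OF elim _ that(1), of "A' N \<omega>"]
          sym[OF elim that(2)] by auto
      then have "?I (?S Ts) A N i = ?I F A N i" "?I (?S Ts) A' N i = ?I F A' N i" if "i \<in> {1..N}" for i
        using that by (auto intro!: Bochner_Integration.integral_cong)
      then show ?case by simp
    qed
  qed
qed

end

section \<open>Orbits of regular polynomial sequences\<close>

lemma poly_maps_nth: "poly_maps d c k t x $ s = poly_val d (c k t s) x"
  by (simp add: poly_maps_def)

lemma has_derivative_monomial:
  "((\<lambda>x :: real ^ 'q::finite. \<Prod>s\<in>UNIV. (x $ s) ^ m s) has_derivative
     (\<lambda>y. \<Sum>r\<in>UNIV. (of_nat (m r) * y $ r * (x $ r) ^ (m r - 1)) * (\<Prod>s\<in>UNIV - {r}. (x $ s) ^ m s))) (at x)"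
proof (rule has_derivative_prod)
  fix r :: 'q
  have "((\<lambda>x :: real ^ 'q. x $ r) has_derivative (\<lambda>y. y $ r)) (at x)"
    by (rule bounded_linear_imp_has_derivative[OF bounded_linear_vec_nth])
  from has_derivative_power[OF this, of "m r"]
  show "((\<lambda>x :: real ^ 'q. (x $ r) ^ m r) has_derivative
      (\<lambda>y. of_nat (m r) * y $ r * (x $ r) ^ (m r - 1))) (at x)"
    by simp
qed

text \<open>The entries are polynomials in \<open>x\<close> with coefficients linear in those of the
  map; this explicit form makes the memory term expandable. For \<open>m r = 0\<close> the truncated
  exponent \<open>m r - 1\<close> does no harm because of the factor
  \<open>real (m r)\<close>.\<close>

lemma jacobian_poly_maps:
  fixes x :: "real ^ 'q::finite"
  shows "jacobian (poly_maps d c k t) (at x) $ s $ r =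
    (\<Sum>m\<in>monomials d. c k t s m *
      (real (m r) * (x $ r) ^ (m r - 1) * (\<Prod>s'\<in>UNIV - {r}. (x $ s') ^ m s')))"
proof -
  define D where "D y = (\<chi> s. \<Sum>m\<in>monomials d. c k t s m *
      (\<Sum>r\<in>UNIV. (real (m r) * y $ r * (x $ r) ^ (m r - 1)) * (\<Prod>s\<in>UNIV - {r}. (x $ s) ^ m s)))"
    for y :: "real ^ 'q"
  have "(poly_maps d c k t has_derivative D) (at x)"
    unfolding has_derivative_componentwise_within[where f = "poly_maps d c k t"]
  proof
    fix b :: "real ^ 'q" assume "b \<in> Basis"
    then obtain s where b: "b = axis s 1" by (auto simp: Basis_vec_def)
    have "((\<lambda>x. \<Sum>m\<in>monomials d. c k t s m * (\<Prod>s\<in>UNIV. (x $ s) ^ m s)) has_derivative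
        (\<lambda>y. \<Sum>m\<in>monomials d. c k t s m *
          (\<Sum>r\<in>UNIV. (real (m r) * y $ r * (x $ r) ^ (m r - 1)) * (\<Prod>s\<in>UNIV - {r}. (x $ s) ^ m s)))) (at x)"
      by (intro has_derivative_sum has_derivative_mult_right has_derivative_monomial)
    then show "((\<lambda>x. poly_maps d c k t x \<bullet> b) has_derivative (\<lambda>y. D y \<bullet> b)) (at x)"
      by (simp add: b inner_axis poly_maps_def poly_val_def D_def)
  qed
  then have "D = frechet_derivative (poly_maps d c k t) (at x)"
    by (rule frechet_derivative_at)
  then have "jacobian (poly_maps d c k t) (at x) = matrix D"
    by (simp add: jacobian_def)
  moreover have "(\<Sum>r'\<in>UNIV. (real (m r') * axis r 1 $ r' * (x $ r') ^ (m r' - 1)) * P r') =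
      real (m r) * (x $ r) ^ (m r - 1) * P r" for m and P :: "'q \<Rightarrow> real"
  proof -
    have "(\<Sum>r'\<in>UNIV. (real (m r') * axis r 1 $ r' * (x $ r') ^ (m r' - 1)) * P r') =
        (\<Sum>r'\<in>UNIV. if r' = r then real (m r) * (x $ r) ^ (m r - 1) * P r else 0)"
      by (intro sum.cong) (auto simp: axis_def)
    then show ?thesis by simp
  qed
  ultimately show ?thesis
    by (simp add: matrix_def D_def)
qed

section \<open>Expansion of the orbit into trees\<close>

context vertex_growth
begin

lemma expandable_poly_val:
  fixes X :: "nat \<Rightarrow> 'w \<Rightarrow> (nat \<Rightarrow> nat \<Rightarrow> real) \<Rightarrow> nat \<Rightarrow> real ^ 'q::finite"
  assumes "\<And>m. m \<in> monomials d \<Longrightarrow> weight (\<lambda>N \<omega> i. c N \<omega> i m)"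
    and "\<And>s. expandable (\<lambda>N \<omega> A i. X N \<omega> A i $ s)"
  shows "expandable (\<lambda>N \<omega> A i. poly_val d (c N \<omega> i) (X N \<omega> A i))"
  unfolding poly_val_def
  by (intro expandable_sum expandable_mult expandable_prod expandable_power
      finite_monomials finite expandable_weight assms)

lemma expandable_amp_orbit:
  fixes x0 :: "nat \<Rightarrow> 'w \<Rightarrow> nat \<Rightarrow> real ^ 'q::finite"
  assumes c: "\<And>t s m. m \<in> monomials d \<Longrightarrow> weight (\<lambda>N \<omega> i. c N \<omega> i t s m)"
    and x0: "\<And>s. weight (\<lambda>N \<omega> i. x0 N \<omega> i $ s)"
  shows "expandable (\<lambda>N \<omega> A i. amp_orbit N A (poly_maps d (c N \<omega>)) (x0 N \<omega>) t i $ s)"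
proof -
  let ?x = "\<lambda>t N \<omega> A i. amp_orbit N A (poly_maps d (c N \<omega>)) (x0 N \<omega>) t i"
  have f: "expandable (\<lambda>N \<omega> A i. poly_maps d (c N \<omega>) i t (?x t' N \<omega> A i) $ s)"
    if "\<And>s. expandable (\<lambda>N \<omega> A i. ?x t' N \<omega> A i $ s)" for t t' s
    unfolding poly_maps_nth by (intro expandable_poly_val c that)
  have J: "expandable (\<lambda>N \<omega> A i. jacobian (poly_maps d (c N \<omega>) i t) (at (?x t' N \<omega> A i)) $ s $ r)"
    if "\<And>s. expandable (\<lambda>N \<omega> A i. ?x t' N \<omega> A i $ s)" for t t' s r
    unfolding jacobian_poly_maps
    by (intro expandable_sum expandable_mult expandable_prod expandable_power
      finite_monomials finite finite_Diff expandable_weight expandable_const c that)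
  have 0: "expandable (\<lambda>N \<omega> A i. ?x 0 N \<omega> A i $ s)" for s
    using expandable_weight[OF x0] by simp
  have 1: "expandable (\<lambda>N \<omega> A i. ?x (Suc 0) N \<omega> A i $ s)" for s
  proof -
    have "expandable (\<lambda>N \<omega> A i. \<Sum>j=1..N. A i j ^ 1 * (poly_maps d (c N \<omega>) j 0 (?x 0 N \<omega> A j) $ s))"
      by (intro expandable_matrix_sum f 0) simp
    then show ?thesis by simp
  qed
  have step: "expandable (\<lambda>N \<omega> A i. ?x (Suc (Suc t)) N \<omega> A i $ s)"
    if IH: "\<And>s. expandable (\<lambda>N \<omega> A i. ?x t N \<omega> A i $ s)"
      "\<And>s. expandable (\<lambda>N \<omega> A i. ?x (Suc t) N \<omega> A i $ s)" for t s
  proof -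
    let ?f = "\<lambda>N \<omega>. poly_maps d (c N \<omega>)"
    have "expandable (\<lambda>N \<omega> A i.
        (\<Sum>j=1..N. A i j ^ 1 * (?f N \<omega> j (Suc t) (?x (Suc t) N \<omega> A j) $ s)) -
        (\<Sum>r\<in>UNIV. (\<Sum>j=1..N. A i j ^ 2 * (jacobian (?f N \<omega> j (Suc t)) (at (?x (Suc t) N \<omega> A j)) $ s $ r)) *
          (?f N \<omega> i t (?x t N \<omega> A i) $ r)))"
      by (intro expandable_diff expandable_sum expandable_mult expandable_matrix_sum f J IH finite) simp_all
    \<comment> \<open>The vector \<open>f i t\<close> of the memory term does not involve the
      summation index \<open>j\<close>. With the sum over components outermost, the memory term
      consists of products of a function of the root and a matrix sum with squared entries.\<close>
    moreover have "?x (Suc (Suc t)) N \<omega> A i $ s =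
        (\<Sum>j=1..N. A i j ^ 1 * (?f N \<omega> j (Suc t) (?x (Suc t) N \<omega> A j) $ s)) -
        (\<Sum>r\<in>UNIV. (\<Sum>j=1..N. A i j ^ 2 * (jacobian (?f N \<omega> j (Suc t)) (at (?x (Suc t) N \<omega> A j)) $ s $ r)) *
          (?f N \<omega> i t (?x t N \<omega> A i) $ r))" for N \<omega> A i
      unfolding sum_distrib_right
      by (subst sum.swap) (simp add: matrix_vector_mult_def sum_distrib_left mult.assoc)
    ultimately show ?thesis by simp
  qed
  \<comment> \<open>The recursion looks back two steps, so two consecutive times are carried through
    the induction.\<close>
  have "(\<forall>s. expandable (\<lambda>N \<omega> A i. ?x t N \<omega> A i $ s)) \<and>
      (\<forall>s. expandable (\<lambda>N \<omega> A i. ?x (Suc t) N \<omega> A i $ s))"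
    by (induction t) (use 0 1 step in \<open>blast+\<close>)
  then show ?thesis by blast
qed

end

section \<open>Independence of the matrix from coefficients and initial condition\<close>

definition environment ::
    "nat \<Rightarrow> (nat \<Rightarrow> 'w measure) \<Rightarrow> (nat \<Rightarrow> 'w \<Rightarrow> nat \<Rightarrow> nat \<Rightarrow> 'q::finite \<Rightarrow> ('q \<Rightarrow> nat) \<Rightarrow> real)
      \<Rightarrow> (nat \<Rightarrow> 'w \<Rightarrow> nat \<Rightarrow> real ^ 'q) \<Rightarrow> nat \<Rightarrow> 'w measure" where
  "environment d M c x0 N = vimage_algebra (space (M N))
     (\<lambda>\<omega>. (coeff_rv d N (c N) \<omega>, initial_rv N (x0 N) \<omega>)) (coeff_space d N \<Otimes>\<^sub>M initial_space N)"

lemma space_environment [simp]: "space (environment d M c x0 N) = space (M N)"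
  by (simp add: environment_def)

lemma coeff_rv_in_space: "coeff_rv d N c \<omega> \<in> space (coeff_space d N)"
  by (simp add: coeff_rv_def coeff_space_def space_PiM)

lemma initial_rv_in_space: "initial_rv N x0 \<omega> \<in> space (initial_space N)"
  by (simp add: initial_rv_def initial_space_def space_PiM)

lemma measurable_environment:
  "(\<lambda>\<omega>. (coeff_rv d N (c N) \<omega>, initial_rv N (x0 N) \<omega>)) \<in>
     measurable (environment d M c x0 N) (coeff_space d N \<Otimes>\<^sub>M initial_space N)"
  unfolding environment_def
  by (rule measurable_vimage_algebra1)
    (simp add: space_pair_measure coeff_rv_in_space initial_rv_in_space)

lemma measurable_coefficient:
  assumes "i \<in> {1..N}" "m \<in> monomials d"
  shows "(\<lambda>\<omega>. c N \<omega> i t s m) \<in> borel_measurable (environment d M c x0 N)"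
proof -
  have idx: "(i, t, s, m) \<in> coeff_index d N" using assms by (simp add: coeff_index_def)
  have "(\<lambda>a. a (i, t, s, m)) \<in> borel_measurable (coeff_space d N)"
    unfolding coeff_space_def by (rule measurable_component_singleton[OF idx])
  from measurable_compose[OF measurable_compose[OF measurable_environment measurable_fst] this]
  show ?thesis using idx by (simp add: coeff_rv_def)
qed

lemma measurable_initial:
  assumes "i \<in> {1..N}"
  shows "(\<lambda>\<omega>. x0 N \<omega> i) \<in> borel_measurable (environment d M c x0 N)"
proof -
  have "(\<lambda>a. a i) \<in> borel_measurable (initial_space N :: (nat \<Rightarrow> real ^ 'q::finite) measure)"
    unfolding initial_space_def by (rule measurable_component_singleton[OF assms])
  from measurable_compose[OF measurable_compose[OF measurable_environment measurable_snd] this]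
  show ?thesis using assms by (simp add: initial_rv_def)
qed

text \<open>This family of generators is stable under intersection, which is what is required to
  extend independence from generators to sigma-algebras.\<close>

lemma sets_environment:
  fixes c :: "nat \<Rightarrow> 'w \<Rightarrow> nat \<Rightarrow> nat \<Rightarrow> 'q::finite \<Rightarrow> ('q \<Rightarrow> nat) \<Rightarrow> real"
  shows "sets (environment d M c x0 N) = sigma_sets (space (M N))
     {coeff_rv d N (c N) -` U \<inter> initial_rv N (x0 N) -` V \<inter> space (M N) |U V.
       U \<in> sets (coeff_space d N) \<and> V \<in> sets (initial_space N)}"
proof -
  let ?S = "coeff_space d N :: (nat \<times> nat \<times> 'q \<times> ('q \<Rightarrow> nat) \<Rightarrow> real) measure"
  let ?T = "initial_space N :: (nat \<Rightarrow> real ^ 'q) measure"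
  let ?f = "\<lambda>\<omega>. (coeff_rv d N (c N) \<omega>, initial_rv N (x0 N) \<omega>)"
  let ?G = "{U \<times> V |U V. U \<in> sets ?S \<and> V \<in> sets ?T}"
  have G: "?G \<subseteq> Pow (space ?S \<times> space ?T)"
    by (rule pair_measure_closed)
  have "sets (?S \<Otimes>\<^sub>M ?T) = sets (sigma (space ?S \<times> space ?T) ?G)"
    using G by (simp add: sets_pair_measure)
  then have "sets (environment d M c x0 N) =
      sets (vimage_algebra (space (M N)) ?f (sigma (space ?S \<times> space ?T) ?G))"
    unfolding environment_def by (rule sets_vimage_algebra_cong)
  also have "\<dots> = sets (sigma (space (M N)) {?f -` W \<inter> space (M N) |W. W \<in> ?G})"
    by (subst vimage_algebra_sigma[OF G]) (auto simp: coeff_rv_in_space initial_rv_in_space)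
  also have "\<dots> = sigma_sets (space (M N)) {?f -` W \<inter> space (M N) |W. W \<in> ?G}"
    by (rule sets_measure_of) auto
  also have "{?f -` W \<inter> space (M N) |W. W \<in> ?G} =
     {coeff_rv d N (c N) -` U \<inter> initial_rv N (x0 N) -` V \<inter> space (M N) |U V.
       U \<in> sets (coeff_space d N) \<and> V \<in> sets (initial_space N)}"
  proof -
    have "?f -` (U \<times> V) \<inter> space (M N) =
        coeff_rv d N (c N) -` U \<inter> initial_rv N (x0 N) -` V \<inter> space (M N)" for U V
      by auto
    moreover have "{?f -` W \<inter> space (M N) |W. W \<in> ?G} =
        {?f -` (U \<times> V) \<inter> space (M N) |U V. U \<in> sets ?S \<and> V \<in> sets ?T}"
      by blast
    ultimately show ?thesis by simp
  qed
  finally show ?thesis .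
qed

text \<open>The coefficients are independent of the pair of matrix and initial condition, and these
  two are independent of each other. Applied in turn, the two facts make the joint probability of
  three events a product, first on the rectangles that generate the environment and then on the
  whole sigma-algebra.\<close>

lemma indep_environment:
  assumes "prob_space (M N)"
    and coeff: "indep_rv (M N) (coeff_space d N) (coeff_rv d N (c N))
          (matrix_space N \<Otimes>\<^sub>M initial_space N)
          (\<lambda>\<omega>. (matrix_rv N (A N) \<omega>, initial_rv N (x0 N) \<omega>))"
    and matrix: "indep_rv (M N) (matrix_space N) (matrix_rv N (A N)) (initial_space N) (initial_rv N (x0 N))"
  shows "prob_space.indep_set (M N) (sets (environment d M c x0 N))
    {matrix_rv N (A N) -` U \<inter> space (M N) |U. U \<in> sets (matrix_space N)}"
proof -
  interpret prob_space "M N" by fact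
  let ?X = "coeff_rv d N (c N)" and ?Y = "initial_rv N (x0 N)" and ?A = "matrix_rv N (A N)"
  let ?G = "{?X -` U \<inter> ?Y -` V \<inter> space (M N) |U V.
       U \<in> sets (coeff_space d N) \<and> V \<in> sets (initial_space N)}"
  let ?\<A> = "{?A -` W \<inter> space (M N) |W. W \<in> sets (matrix_space N)}"
  have meas: "?X \<in> measurable (M N) (coeff_space d N)" "?A \<in> measurable (M N) (matrix_space N)"
      "?Y \<in> measurable (M N) (initial_space N)"
    using coeff matrix by (auto simp: indep_rv_def)
  have XV: "?X -` U \<inter> ?Y -` V \<inter> space (M N) = (?X -` U \<inter> space (M N)) \<inter> (?Y -` V \<inter> space (M N))" for U V
    by auto
  have prob_X: "prob ((?X -` U \<inter> space (M N)) \<inter> (?A -` W \<inter> ?Y -` V \<inter> space (M N))) =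
      prob (?X -` U \<inter> space (M N)) * prob (?A -` W \<inter> ?Y -` V \<inter> space (M N))"
    if "U \<in> sets (coeff_space d N)" "V \<in> sets (initial_space N)" "W \<in> sets (matrix_space N)" for U V W
  proof -
    have "?A -` W \<inter> ?Y -` V \<inter> space (M N) = (\<lambda>\<omega>. (?A \<omega>, ?Y \<omega>)) -` (W \<times> V) \<inter> space (M N)"
      by auto
    moreover have "W \<times> V \<in> sets (matrix_space N \<Otimes>\<^sub>M initial_space N)"
      using that by (intro pair_measureI)
    ultimately show ?thesis
      using coeff that(1) unfolding indep_rv_def by (intro indep_setD) auto
  qed
  have prob_A: "prob (?A -` W \<inter> ?Y -` V \<inter> space (M N)) =
      prob (?A -` W \<inter> space (M N)) * prob (?Y -` V \<inter> space (M N))"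
    if "V \<in> sets (initial_space N)" "W \<in> sets (matrix_space N)" for V W
  proof -
    have "?A -` W \<inter> ?Y -` V \<inter> space (M N) = (?A -` W \<inter> space (M N)) \<inter> (?Y -` V \<inter> space (M N))"
      by auto
    then show ?thesis
      using matrix that unfolding indep_rv_def by (auto dest!: indep_setD)
  qed
  have "indep_set ?G ?\<A>"
  proof (rule indep_setI)
    show "?G \<subseteq> events"
      unfolding XV using meas by (auto intro!: sets.Int measurable_sets)
    show "?\<A> \<subseteq> events"
      using meas by (auto intro: measurable_sets)
    fix a b assume "a \<in> ?G" "b \<in> ?\<A>"
    then obtain U V W where a: "a = ?X -` U \<inter> ?Y -` V \<inter> space (M N)" and b: "b = ?A -` W \<inter> space (M N)"
      and UVW: "U \<in> sets (coeff_space d N)" "V \<in> sets (initial_space N)" "W \<in> sets (matrix_space N)"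
      by blast
    \<comment> \<open>With the full space in place of the event of the matrix, \<open>prob_X\<close>
      becomes independence of the coefficients and the initial condition, which evaluates
      \<open>prob a\<close>.\<close>
    have top: "?A -` space (matrix_space N) \<inter> Z \<inter> space (M N) = Z \<inter> space (M N)" for Z
      using measurable_space[OF meas(2)] by auto
    have "a \<inter> b = (?X -` U \<inter> space (M N)) \<inter> (?A -` W \<inter> ?Y -` V \<inter> space (M N))"
      unfolding a b by auto
    then have "prob (a \<inter> b) =
        prob (?X -` U \<inter> space (M N)) * prob (?Y -` V \<inter> space (M N)) * prob b"
      by (simp add: prob_X[OF UVW] prob_A[OF UVW(2,3)] b)
    moreover have "prob a = prob (?X -` U \<inter> space (M N)) * prob (?Y -` V \<inter> space (M N))"
      using prob_X[OF UVW(1,2) sets.top] by (simp only: top a XV)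
    ultimately show "prob (a \<inter> b) = prob a * prob b" by simp
  qed
  moreover have "Int_stable ?G"
  proof (rule Int_stableI)
    fix a b assume "a \<in> ?G" "b \<in> ?G"
    then obtain U V U' V' where *: "a = ?X -` U \<inter> ?Y -` V \<inter> space (M N)"
        "b = ?X -` U' \<inter> ?Y -` V' \<inter> space (M N)"
        "U \<in> sets (coeff_space d N)" "V \<in> sets (initial_space N)"
        "U' \<in> sets (coeff_space d N)" "V' \<in> sets (initial_space N)" by blast
    then have "a \<inter> b = ?X -` (U \<inter> U') \<inter> ?Y -` (V \<inter> V') \<inter> space (M N)" by auto
    with * show "a \<inter> b \<in> ?G" by (blast intro: sets.Int)
  qed
  moreover have "Int_stable ?\<A>"
  proof (rule Int_stableI)
    fix a b assume "a \<in> ?\<A>" "b \<in> ?\<A>"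
    then obtain U V where *: "a = ?A -` U \<inter> space (M N)" "b = ?A -` V \<inter> space (M N)"
        "U \<in> sets (matrix_space N)" "V \<in> sets (matrix_space N)" by blast
    then have "a \<inter> b = ?A -` (U \<inter> V) \<inter> space (M N)" by auto
    with * show "a \<inter> b \<in> ?\<A>" by (blast intro: sets.Int)
  qed
  ultimately have "indep_set (sets (environment d M c x0 N)) (sigma_sets (space (M N)) ?\<A>)"
    unfolding sets_environment by (rule indep_set_sigma_sets)
  then show ?thesis
    unfolding indep_sets2_eq by (blast intro: sigma_sets.Basic)
qed

lemma regular_sparse_ensemble:
  assumes "regular_polynomial_sequence C d M A c x0" "N \<ge> 1"
  shows "sparse_ensemble (M N) (environment d M c x0 N) N C (A N)"
proof -
  have reg: "prob_space (M N)"
      "\<forall>\<omega>\<in>space (M N). amp_instance N (A N \<omega>) (poly_maps d (c N \<omega>))"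
      "prob_space.indep_vars (M N) (\<lambda>_. borel) (\<lambda>(i, j) \<omega>. A N \<omega> i j) (upper_pairs N)"
      "\<forall>(i, j)\<in>upper_pairs N.
           integrable (M N) (\<lambda>\<omega>. A N \<omega> i j) \<and> (LINT \<omega>|M N. A N \<omega> i j) = 0 \<and>
           subgaussian (M N) (\<lambda>\<omega>. A N \<omega> i j) (C / real N)"
      "indep_rv (M N) (coeff_space d N) (coeff_rv d N (c N))
          (matrix_space N \<Otimes>\<^sub>M initial_space N)
          (\<lambda>\<omega>. (matrix_rv N (A N) \<omega>, initial_rv N (x0 N) \<omega>))"
      "indep_rv (M N) (matrix_space N) (matrix_rv N (A N)) (initial_space N) (initial_rv N (x0 N))"
    using assms unfolding regular_polynomial_sequence_def by blast+
  show ?thesis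
  proof (intro sparse_ensemble.intro sparse_ensemble_axioms.intro)
    show "matrix_rv N (A N) \<in> measurable (M N) (matrix_space N)"
      using reg(6) by (simp add: indep_rv_def)
  qed (use reg assms(2) indep_environment[of M N d c A x0] in \<open>auto simp: amp_instance_def\<close>)
qed

section \<open>Growth of the initial condition\<close>

lemma one_plus_power_le: "(1 + y) ^ k \<le> 2 ^ k * (1 + y ^ k)" if "y \<ge> 0" for y :: real
proof (cases "y \<le> 1")
  case True
  then have "(1 + y) ^ k \<le> 2 ^ k" using that by (intro power_mono) auto
  also have "\<dots> \<le> 2 ^ k * (1 + y ^ k)" using that by simp
  finally show ?thesis .
next
  case False
  then have "(1 + y) ^ k \<le> (2 * y) ^ k" by (intro power_mono) auto
  also have "\<dots> = 2 ^ k * y ^ k" by (rule power_mult_distrib)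
  also have "\<dots> \<le> 2 ^ k * (1 + y ^ k)" by simp
  finally show ?thesis .
qed

text \<open>On the tame event all moments are controlled by the exponential one. From
  \<open>y \<le> 1 + y\<^sup>2\<close> one gets \<open>1 + y \<le> (2 + C) * (1 + ?z)\<close> for
  \<open>?z = y\<^sup>2 / C\<close>, and a power of \<open>1 + ?z\<close> is absorbed by
  \<open>exp (1 + ?z)\<close>, whence the factor \<open>exp 1\<close>.\<close>

lemma one_plus_power_le_exp:
  assumes "C > 0" "y \<ge> (0 :: real)"
  shows "(1 + y) ^ k \<le> (2 + C) ^ k * fact k * exp 1 * exp (y\<^sup>2 / C)"
proof -
  let ?z = "y\<^sup>2 / C"
  have z: "?z \<ge> 0" using assms by simp
  have "y \<le> 1 + y\<^sup>2"
    using zero_le_power2[of "y - 1"] zero_le_power2[of y] assms(2)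
    by (simp add: power2_eq_square algebra_simps)
  then have "1 + y \<le> 2 + C * ?z" using assms by simp
  moreover have "2 + C * z \<le> (2 + C) * (1 + z)" if "z \<ge> 0" for z
    using assms that by (simp add: algebra_simps)
  ultimately have "1 + y \<le> (2 + C) * (1 + ?z)" using z by (meson order_trans)
  then have "(1 + y) ^ k \<le> ((2 + C) * (1 + ?z)) ^ k" using assms by (intro power_mono) auto
  also have "\<dots> = (2 + C) ^ k * (1 + ?z) ^ k" by (rule power_mult_distrib)
  also have "(1 + ?z) ^ k \<le> fact k * exp (1 + ?z)"
    using z by (intro power_le_fact_exp) simp
  finally show ?thesis using assms by (simp add: exp_add mult_left_mono mult_ac)
qed

theorem theorem3:
  fixes C B :: real and d t :: nat
    and M :: "nat \<Rightarrow> 'w measure"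
    and A A' :: "nat \<Rightarrow> 'w \<Rightarrow> nat \<Rightarrow> nat \<Rightarrow> real"
    and c :: "nat \<Rightarrow> 'w \<Rightarrow> nat \<Rightarrow> nat \<Rightarrow> 'q::finite \<Rightarrow> ('q \<Rightarrow> nat) \<Rightarrow> real"
    and x0 :: "nat \<Rightarrow> 'w \<Rightarrow> nat \<Rightarrow> real ^ 'q"
    and p :: "nat \<Rightarrow> nat \<Rightarrow> real ^ 'q \<Rightarrow> real"
  defines "x \<equiv> \<lambda>N \<omega>. amp_orbit N (A N \<omega>) (poly_maps d (c N \<omega>)) (x0 N \<omega>)"
    and "x' \<equiv> \<lambda>N \<omega>. amp_orbit N (A' N \<omega>) (poly_maps d (c N \<omega>)) (x0 N \<omega>)"
    and "G \<equiv> \<lambda>N. tame_event C N (M N) (x0 N)"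
  assumes "C > 0"
    and "regular_polynomial_sequence C d M A c x0"
    and "regular_polynomial_sequence C d M A' c x0"
    and "\<And>N i j. 1 \<le> i \<Longrightarrow> i < j \<Longrightarrow> j \<le> N \<Longrightarrow>
           (LINT \<omega>|M N. (A N \<omega> i j)\<^sup>2) = (LINT \<omega>|M N. (A' N \<omega> i j)\<^sup>2)"
    and "\<And>N i. 1 \<le> i \<Longrightarrow> i \<le> N \<Longrightarrow> bounded_polynomial d B (p N i)"
  shows "((\<lambda>N. (1 / real N) * (\<Sum>i=1..N.
             ((LINT \<omega>:G N|M N. p N i (x N \<omega> t i)) - (LINT \<omega>:G N|M N. p N i (x' N \<omega> t i)))))
           \<longlonglongrightarrow> 0) \<and>
         (bounded_initial_moments M x0 \<longrightarrow>
          (\<lambda>N. (1 / real N) * (\<Sum>i=1..N.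
             ((LINT \<omega>|M N. p N i (x N \<omega> t i)) - (LINT \<omega>|M N. p N i (x' N \<omega> t i)))))
           \<longlonglongrightarrow> 0)"
proof -
  let ?H = "environment d M c x0" and ?h = "\<lambda>N \<omega> v. 1 + norm (x0 N \<omega> v)"
  note ens = regular_sparse_ensemble[OF assms(5)] regular_sparse_ensemble[OF assms(6)]
  have inst: "amp_instance N (A N \<omega>) (poly_maps d (c N \<omega>))"
      "amp_instance N (A' N \<omega>) (poly_maps d (c N \<omega>))" if "N \<ge> 1" "\<omega> \<in> space (M N)" for N \<omega>
    using assms(5,6) that unfolding regular_polynomial_sequence_def by blast+
  have coeff_le: "\<bar>c N \<omega> i t s m\<bar> \<le> C"
    if "N \<ge> 1" "\<omega> \<in> space (M N)" "i \<in> {1..N}" "m \<in> monomials d" for N \<omega> i t s m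
  proof -
    have "\<forall>(i, t, s, m)\<in>coeff_index d N. \<bar>c N \<omega> i t s m\<bar> \<le> C"
      using assms(5) that(1,2) unfolding regular_polynomial_sequence_def by blast
    moreover have "(i, t, s, m) \<in> coeff_index d N" using that by (simp add: coeff_index_def)
    ultimately show ?thesis by blast
  qed
  interpret vertex_growth ?H ?h
  proof
    fix N v assume "(1::nat) \<le> N" "v \<in> {1..N}"
    then show "(\<lambda>\<omega>. ?h N \<omega> v) \<in> borel_measurable (?H N)"
      by (intro borel_measurable_add borel_measurable_const
        measurable_compose[OF measurable_initial borel_measurable_norm])
  qed simp
  have weight_c: "weight (\<lambda>N \<omega> i. c N \<omega> i t s m)" if "m \<in> monomials d" for t s m
    unfolding weight_def using coeff_le that \<open>C > 0\<close>
    by (intro exI[of _ C] exI[of _ 0]) (auto intro!: measurable_coefficient)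
  have weight_x0: "weight (\<lambda>N \<omega> i. x0 N \<omega> i $ s)" for s
    unfolding weight_def
  proof (intro exI[of _ 1] exI[of _ 1] conjI allI impI ballI)
    fix N i assume "(1::nat) \<le> N" "i \<in> {1..N}"
    have "(\<lambda>v :: real ^ 'q. v $ s) \<in> borel_measurable borel"
      by (intro borel_measurable_continuous_onI continuous_intros)
    then show "(\<lambda>\<omega>. x0 N \<omega> i $ s) \<in> borel_measurable (?H N)"
      by (rule measurable_compose[OF measurable_initial[OF \<open>i \<in> {1..N}\<close>]])
    fix \<omega>
    show "\<bar>x0 N \<omega> i $ s\<bar> \<le> 1 * ?h N \<omega> i ^ 1"
      using component_le_norm_cart[of "x0 N \<omega> i" s] by simp
  qed simp
  \<comment> \<open>The test polynomials are deterministic, so their coefficients, chosen for every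
    \<open>N\<close> and \<open>i\<close>, are weights with growth exponent 0, and applying the
    polynomials preserves expandability.\<close>
  have "\<forall>N i. \<exists>b. 1 \<le> i \<and> i \<le> N \<longrightarrow> (\<forall>m\<in>monomials d. \<bar>b m\<bar> \<le> B) \<and> p N i = poly_val d b"
    using assms(8) unfolding bounded_polynomial_def by blast
  then obtain b where b: "\<And>N i. 1 \<le> i \<Longrightarrow> i \<le> N \<Longrightarrow>
      (\<forall>m\<in>monomials d. \<bar>b N i m\<bar> \<le> B) \<and> p N i = poly_val d (b N i)"
    by metis
  have weight_b: "weight (\<lambda>N \<omega> i. b N i m)" if "m \<in> monomials d" for m
    unfolding weight_def
  proof (intro exI[of _ "\<bar>B\<bar>"] exI[of _ 0] conjI allI impI ballI)
    fix N i \<omega> assume "(1::nat) \<le> N" "i \<in> {1..N}"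
    then show "\<bar>b N i m\<bar> \<le> \<bar>B\<bar> * ?h N \<omega> i ^ 0"
      using b[of i N] that by fastforce
  qed auto
  let ?F = "\<lambda>N \<omega> A i. poly_val d (b N i) (amp_orbit N A (poly_maps d (c N \<omega>)) (x0 N \<omega>) t i)"
  have "expandable ?F"
    by (intro expandable_poly_val[where c = "\<lambda>N \<omega> i. b N i"] weight_b expandable_amp_orbit weight_c weight_x0)
  note difference = expandable_difference[OF ens _ _ _ _ _ _ this]
  \<comment> \<open>Both claims are instances: \<open>\<phi> N\<close> is the indicator of
    \<open>G N\<close> for the first and the constant 1 for the second.\<close>
  have limit: "(\<lambda>N. (1 / real N) * (\<Sum>i=1..N.
      ((LINT \<omega>|M N. \<phi> N \<omega> * p N i (x N \<omega> t i)) - (LINT \<omega>|M N. \<phi> N \<omega> * p N i (x' N \<omega> t i)))))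
      \<longlonglongrightarrow> 0"
    if "\<And>N. N \<ge> 1 \<Longrightarrow> \<phi> N \<in> borel_measurable (?H N)" "\<And>N \<omega>. \<phi> N \<omega> \<ge> (0::real)"
      "\<And>k. \<exists>K. \<forall>\<^sub>F N in sequentially.
        (\<forall>i\<in>{1..N}. integrable (M N) (\<lambda>\<omega>. \<phi> N \<omega> * ?h N \<omega> i ^ k)) \<and>
        (1 / real N) * (\<Sum>i=1..N. LINT \<omega>|M N. \<phi> N \<omega> * ?h N \<omega> i ^ k) \<le> K" for \<phi>
  proof -
    have "(\<lambda>N. (1 / real N) * (\<Sum>i=1..N. (LINT \<omega>|M N. \<phi> N \<omega> * ?F N \<omega> (A N \<omega>) i) -
        (LINT \<omega>|M N. \<phi> N \<omega> * ?F N \<omega> (A' N \<omega>) i))) \<longlonglongrightarrow> 0"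
    proof (rule difference)
      show "A N \<omega> i j = A N \<omega> j i" "A' N \<omega> i j = A' N \<omega> j i"
        if "N \<ge> 1" "\<omega> \<in> space (M N)" "i \<in> {1..N}" "j \<in> {1..N}" for N \<omega> i j
        using inst[OF that(1,2)] that(3,4) unfolding amp_instance_def by blast+
      show "(LINT \<omega>|M N. (A N \<omega> i j)\<^sup>2) = (LINT \<omega>|M N. (A' N \<omega> i j)\<^sup>2)"
        if "(i, j) \<in> upper_pairs N" for N i j
        using assms(7)[of i j N] that by (simp add: upper_pairs_def)
    qed (use that in auto)
    moreover have "(\<Sum>i=1..N. (LINT \<omega>|M N. \<phi> N \<omega> * ?F N \<omega> (A N \<omega>) i) -
        (LINT \<omega>|M N. \<phi> N \<omega> * ?F N \<omega> (A' N \<omega>) i)) = (\<Sum>i=1..N.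
      ((LINT \<omega>|M N. \<phi> N \<omega> * p N i (x N \<omega> t i)) - (LINT \<omega>|M N. \<phi> N \<omega> * p N i (x' N \<omega> t i))))" for N
      by (intro sum.cong refl) (simp add: x_def x'_def b)
    ultimately show ?thesis by simp
  qed
  have sub: "f \<in> borel_measurable (M N)" if "N \<ge> 1" "f \<in> borel_measurable (?H N)" for f :: "'w \<Rightarrow> real" and N
  proof -
    interpret A: sparse_ensemble "M N" "?H N" N C "A N" by (rule ens(1)[OF that(1)])
    show ?thesis
      using that(2) A.indep_setD_ev1[OF A.indep_H] by (auto simp: measurable_def)
  qed
  show ?thesis
  proof (intro conjI impI)
    \<comment> \<open>The event is determined by the initial condition, so restricting to it
      preserves independence from the matrix.\<close>
    have G_sets: "G N \<in> sets (?H N)" for N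
    proof -
      have "(\<lambda>v :: real ^ 'q. exp ((norm v)\<^sup>2 / C)) \<in> borel_measurable borel"
        by measurable
      then have "(\<lambda>\<omega>. \<Sum>i=1..N. exp ((norm (x0 N \<omega> i))\<^sup>2 / C)) \<in> borel_measurable (?H N)"
        by (intro borel_measurable_sum measurable_compose[OF measurable_initial]) auto
      then show ?thesis
        unfolding G_def tame_event_def by (simp add: borel_measurable_iff_le)
    qed
    have "(\<lambda>N. (1 / real N) * (\<Sum>i=1..N.
      ((LINT \<omega>|M N. indicator (G N) \<omega> * p N i (x N \<omega> t i)) -
       (LINT \<omega>|M N. indicator (G N) \<omega> * p N i (x' N \<omega> t i))))) \<longlonglongrightarrow> 0"
    proof (rule limit)
      show "indicator (G N) \<in> borel_measurable (?H N)" for N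
        by (rule borel_measurable_indicator[OF G_sets])
      fix k
      define D where "D = (2 + C) ^ k * fact k * exp 1"
      have D: "D \<ge> 0" using \<open>C > 0\<close> by (simp add: D_def)
      have h_le: "?h N \<omega> i ^ k \<le> D * exp ((norm (x0 N \<omega> i))\<^sup>2 / C)" for N \<omega> i
        unfolding D_def using one_plus_power_le_exp[OF \<open>C > 0\<close>] by simp
      \<comment> \<open>A pointwise bound: on \<open>G N\<close> it follows from the inequality that
        defines the event, and elsewhere the left side is 0. It also bounds each nonnegative
        summand, which gives integrability.\<close>
      have sum_le: "(\<Sum>i=1..N. indicator (G N) \<omega> * ?h N \<omega> i ^ k) \<le> D * (real N * C)" for N \<omega>
      proof (cases "\<omega> \<in> G N")
        case True
        have "(\<Sum>i=1..N. ?h N \<omega> i ^ k) \<le> D * (\<Sum>i=1..N. exp ((norm (x0 N \<omega> i))\<^sup>2 / C))"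
          unfolding sum_distrib_left by (intro sum_mono h_le)
        also have "\<dots> \<le> D * (real N * C)"
          using True D by (intro mult_left_mono) (auto simp: G_def tame_event_def)
        finally show ?thesis using True by simp
      qed (use D \<open>C > 0\<close> in simp)
      have int: "integrable (M N) (\<lambda>\<omega>. indicator (G N) \<omega> * ?h N \<omega> i ^ k)"
        if "N \<ge> 1" "i \<in> {1..N}" for N i
      proof -
        interpret A: sparse_ensemble "M N" "?H N" N C "A N" by (rule ens(1)[OF that(1)])
        show ?thesis
        proof (rule A.integrable_const_bound[where B = "D * (real N * C)"])
          show "(\<lambda>\<omega>. indicator (G N) \<omega> * ?h N \<omega> i ^ k) \<in> borel_measurable (M N)"
            using that by (intro sub borel_measurable_times borel_measurable_power
              borel_measurable_indicator G_sets measurable_h)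
          have "indicator (G N) \<omega> * ?h N \<omega> i ^ k \<le> D * (real N * C)" for \<omega>
            using member_le_sum[of i "{1..N}" "\<lambda>i. indicator (G N) \<omega> * ?h N \<omega> i ^ k"] that sum_le[of N \<omega>]
            by simp
          then show "AE \<omega> in M N. norm (indicator (G N) \<omega> * ?h N \<omega> i ^ k) \<le> D * (real N * C)"
            by (simp add: abs_mult)
        qed
      qed
      have "(\<forall>i\<in>{1..N}. integrable (M N) (\<lambda>\<omega>. indicator (G N) \<omega> * ?h N \<omega> i ^ k)) \<and>
        (1 / real N) * (\<Sum>i=1..N. LINT \<omega>|M N. indicator (G N) \<omega> * ?h N \<omega> i ^ k) \<le> D * C"
        if N: "N \<ge> 1" for N
      proof -
        interpret A: sparse_ensemble "M N" "?H N" N C "A N" by (rule ens(1)[OF N])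
        have "(\<Sum>i=1..N. LINT \<omega>|M N. indicator (G N) \<omega> * ?h N \<omega> i ^ k) =
            (LINT \<omega>|M N. (\<Sum>i=1..N. indicator (G N) \<omega> * ?h N \<omega> i ^ k))"
          using int[OF N] by (intro Bochner_Integration.integral_sum[symmetric])
        also have "\<dots> \<le> (LINT \<omega>|M N. D * (real N * C))"
          using int[OF N] sum_le by (intro integral_mono Bochner_Integration.integrable_sum A.integrable_const)
        also have "\<dots> = D * (real N * C)" by (simp add: A.prob_space)
        finally show ?thesis using int[OF N] N by (simp add: field_simps)
      qed
      then show "\<exists>K. \<forall>\<^sub>F N in sequentially.
        (\<forall>i\<in>{1..N}. integrable (M N) (\<lambda>\<omega>. indicator (G N) \<omega> * ?h N \<omega> i ^ k)) \<and>
        (1 / real N) * (\<Sum>i=1..N. LINT \<omega>|M N. indicator (G N) \<omega> * ?h N \<omega> i ^ k) \<le> K"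
        unfolding eventually_sequentially by blast
    qed simp
    then show "(\<lambda>N. (1 / real N) * (\<Sum>i=1..N.
             ((LINT \<omega>:G N|M N. p N i (x N \<omega> t i)) - (LINT \<omega>:G N|M N. p N i (x' N \<omega> t i)))))
           \<longlonglongrightarrow> 0"
      by (simp add: set_lebesgue_integral_def)
  next
    assume "bounded_initial_moments M x0"
    then have bounded: "\<exists>K. \<forall>\<^sub>F N in sequentially.
        (\<forall>i\<in>{1..N}. integrable (M N) (\<lambda>\<omega>. norm (x0 N \<omega> i) ^ k)) \<and>
        (1 / real N) * (\<Sum>i=1..N. LINT \<omega>|M N. norm (x0 N \<omega> i) ^ k) \<le> K" for k
      unfolding bounded_initial_moments_def by blast
    have "(\<lambda>N. (1 / real N) * (\<Sum>i=1..N.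
      ((LINT \<omega>|M N. 1 * p N i (x N \<omega> t i)) - (LINT \<omega>|M N. 1 * p N i (x' N \<omega> t i))))) \<longlonglongrightarrow> 0"
    proof (rule limit)
      fix k
      obtain K where K: "\<forall>\<^sub>F N in sequentially.
          (\<forall>i\<in>{1..N}. integrable (M N) (\<lambda>\<omega>. norm (x0 N \<omega> i) ^ k)) \<and>
          (1 / real N) * (\<Sum>i=1..N. LINT \<omega>|M N. norm (x0 N \<omega> i) ^ k) \<le> K"
        using bounded by blast
      have "\<forall>\<^sub>F N in sequentially.
        (\<forall>i\<in>{1..N}. integrable (M N) (\<lambda>\<omega>. 1 * ?h N \<omega> i ^ k)) \<and>
        (1 / real N) * (\<Sum>i=1..N. LINT \<omega>|M N. 1 * ?h N \<omega> i ^ k) \<le> 2 ^ k * (1 + K)"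
        using K eventually_ge_at_top[of 1]
      proof eventually_elim
        case (elim N)
        interpret A: sparse_ensemble "M N" "?H N" N C "A N" by (rule ens(1)[OF elim(2)])
        \<comment> \<open>Moments of \<open>?h\<close> reduce to moments of the norm of the same
          order, so the bound \<open>K\<close> for order \<open>k\<close> is enough and yields
          \<open>2 ^ k * (1 + K)\<close>.\<close>
        have h_le: "?h N \<omega> i ^ k \<le> 2 ^ k * (1 + norm (x0 N \<omega> i) ^ k)" for \<omega> i
          by (rule one_plus_power_le) simp
        have int: "integrable (M N) (\<lambda>\<omega>. norm (x0 N \<omega> i) ^ k)"
            "integrable (M N) (\<lambda>\<omega>. 2 ^ k * (1 + norm (x0 N \<omega> i) ^ k))" if "i \<in> {1..N}" for i
          using elim(1) that by simp_all
        have int_h: "integrable (M N) (\<lambda>\<omega>. ?h N \<omega> i ^ k)" if i: "i \<in> {1..N}" for i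
        proof (rule Bochner_Integration.integrable_bound[OF int(2)[OF i]])
          show "(\<lambda>\<omega>. ?h N \<omega> i ^ k) \<in> borel_measurable (M N)"
            using elim(2) i by (intro sub borel_measurable_power measurable_h)
          show "AE \<omega> in M N. norm (?h N \<omega> i ^ k) \<le> norm (2 ^ k * (1 + norm (x0 N \<omega> i) ^ k))"
            using h_le by (auto intro!: AE_I2 order_trans[OF h_le])
        qed
        have "(\<Sum>i=1..N. LINT \<omega>|M N. ?h N \<omega> i ^ k) \<le>
            (\<Sum>i=1..N. LINT \<omega>|M N. 2 ^ k * (1 + norm (x0 N \<omega> i) ^ k))"
          by (intro sum_mono integral_mono int_h int h_le)
        also have "\<dots> = (\<Sum>i=1..N. 2 ^ k * (1 + (LINT \<omega>|M N. norm (x0 N \<omega> i) ^ k)))"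
          using int(1) by (intro sum.cong refl) (simp add: A.prob_space)
        also have "\<dots> = 2 ^ k * (real N + (\<Sum>i=1..N. LINT \<omega>|M N. norm (x0 N \<omega> i) ^ k))"
          by (simp add: sum.distrib flip: sum_distrib_left)
        finally have "(1 / real N) * (\<Sum>i=1..N. LINT \<omega>|M N. ?h N \<omega> i ^ k) \<le>
            (1 / real N) * (2 ^ k * (real N + (\<Sum>i=1..N. LINT \<omega>|M N. norm (x0 N \<omega> i) ^ k)))"
          by (intro mult_left_mono) auto
        also have "\<dots> = 2 ^ k * (1 + (1 / real N) * (\<Sum>i=1..N. LINT \<omega>|M N. norm (x0 N \<omega> i) ^ k))"
          using elim(2) by (simp add: field_simps)
        also have "\<dots> \<le> 2 ^ k * (1 + K)"
          using elim(1) by (intro mult_left_mono add_left_mono) auto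
        finally show ?case using int_h by simp
      qed
      then show "\<exists>K. \<forall>\<^sub>F N in sequentially.
        (\<forall>i\<in>{1..N}. integrable (M N) (\<lambda>\<omega>. 1 * ?h N \<omega> i ^ k)) \<and>
        (1 / real N) * (\<Sum>i=1..N. LINT \<omega>|M N. 1 * ?h N \<omega> i ^ k) \<le> K" by blast
    qed simp_all
    then show "(\<lambda>N. (1 / real N) * (\<Sum>i=1..N.
             ((LINT \<omega>|M N. p N i (x N \<omega> t i)) - (LINT \<omega>|M N. p N i (x' N \<omega> t i)))))
           \<longlonglongrightarrow> 0" by simp
  qed
qed

end
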